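(* Let $\tilde K=\min(n,K)$ and $\epsilon>0$. There exists a multi-pass streaming algorithm (\textsc{Sieve+Max}) that uses $O(\tilde K)$ space and $O(1/\epsilon)$ passes over the stream and outputs a $(\tfrac12-\epsilon)$-approximation to the problem of maximizing a non-negative monotone submodular function subject to a knapsack constraint, with query complexity and running time $O\big(n(1/\epsilon+\log\tilde K)\big)$.
   Context: Problem (submodular maximization under a knapsack constraint): a finite universe $U$ and a set $E=\{e_1,\dots,e_n\}\subseteq U$ of $n$ items are given, together with a cost function $c$ on items, a capacity $K>0$, and value-oracle access to a set function $f:2^U\to\mathbb R_{\ge 0}$ that is monotone ($f(S)\le f(T)$ for $S\subseteq T$) and submodular ($f(T\cup\{e\})-f(T)\le f(S\cup\{e\})-f(S)$ for all $S\subseteq T\subseteq U$, $e\in U$). For $S\subseteq E$, $c(S)=\sum_{e\in S}c(e)$; $S$ is feasible if $c(S)\le K$; $\mathsf{OPT}$ denotes an optimal feasible set. Standing assumption: $1\le c(e)\le K$ for every item, so $\tilde K=\min(n,K)$ bounds the size of any feasible set. An $\alpha$-approximation is a feasible output $S$ with $f(S)\ge\alpha f(\mathsf{OPT})$. Multi-pass streaming model: the algorithm is given $K$ and the items $e_1,\dots,e_n$ arrive sequentially as a stream; it may make several sequential passes over the stream, and space is the auxiliary storage (number of items stored) used during execution. Query complexity counts oracle evaluations of $f$. *)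

theory Defs
  imports Complex_Main
begin

section \<open>Submodular maximization under a knapsack constraint\<close>

definition monotone_submodular :: "'a set \<Rightarrow> ('a set \<Rightarrow> real) \<Rightarrow> bool" where
  "monotone_submodular U f \<longleftrightarrow>
     (\<forall>S. S \<subseteq> U \<longrightarrow> 0 \<le> f S) \<and>
     (\<forall>S T. S \<subseteq> T \<and> T \<subseteq> U \<longrightarrow> f S \<le> f T) \<and>
     (\<forall>S T e. S \<subseteq> T \<and> T \<subseteq> U \<and> e \<in> U \<longrightarrow>
        f (T \<union> {e}) - f T \<le> f (S \<union> {e}) - f S)"

definition knapsack_instance ::
  "'a set \<Rightarrow> 'a list \<Rightarrow> ('a set \<Rightarrow> real) \<Rightarrow> ('a \<Rightarrow> real) \<Rightarrow> real \<Rightarrow> bool" where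
  "knapsack_instance U es f c K \<longleftrightarrow>
     finite U \<and> distinct es \<and> set es \<subseteq> U \<and> monotone_submodular U f \<and>
     0 < K \<and> (\<forall>e\<in>set es. 1 \<le> c e \<and> c e \<le> K)"

definition feasible :: "'a set \<Rightarrow> ('a \<Rightarrow> real) \<Rightarrow> real \<Rightarrow> 'a set \<Rightarrow> bool" where
  "feasible E c K S \<longleftrightarrow> S \<subseteq> E \<and> (\<Sum>e\<in>S. c e) \<le> K"

definition approximation ::
  "real \<Rightarrow> 'a set \<Rightarrow> ('a set \<Rightarrow> real) \<Rightarrow> ('a \<Rightarrow> real) \<Rightarrow> real \<Rightarrow> 'a set \<Rightarrow> bool" where
  "approximation \<alpha> E f c K S \<longleftrightarrow>
     feasible E c K S \<and>
     (\<exists>OPT. is_arg_max f (feasible E c K) OPT \<and> f S \<ge> \<alpha> * f OPT)"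


section \<open>Multi-pass streaming machine\<close>

text \<open>
  A streaming algorithm is a program for a real-arithmetic random access machine with an oracle
  for \<open>f\<close>. Items are opaque: a program can only copy an item between cells, read its cost, and name
  it in an oracle call. Apart from the item currently under the stream head, items are available
  only in the item memory. A program contains finitely many numeric registers; unbounded storage is
  provided by an item memory and a numeric memory, both addressed by natural numbers.
\<close>

datatype nexp = NConst nat | NReg nat | NAdd nexp nexp | NSub nexp nexp | NHalf nexp

datatype iref = Cur | Cell nexp

datatype rexp =
    RConst int | RReg nat | RMem nexp | ROfNat nexp | RCost iref
  | RAdd rexp rexp | RSub rexp rexp | RMul rexp rexp | RDiv rexp rexp

datatype bexp = NLess nexp nexp | RLess rexp rexp | BNot bexp | BAnd bexp bexp

text \<open>
  \<open>Query r a b xs\<close> puts into real register \<open>r\<close> the value of \<open>f\<close> on the set of items in the cells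
  \<open>a, \<dots>, b - 1\<close> together with the items referenced by \<open>xs\<close>.
\<close>

datatype com =
    Skip
  | NSet nat nexp
  | RSet nat rexp
  | RStore nexp rexp
  | IStore nexp iref
  | Query nat nexp nexp "iref list"
  | Seq com com
  | Cond bexp com com
  | While bexp com

text \<open>
  Passes occur only at the outer level, so they are never nested.
\<close>

datatype prog =
    Local com
  | Pass com
  | PSeq prog prog
  | PCond bexp prog prog
  | PWhile bexp prog

text \<open>
  The last five fields only record resource usage; \<open>icells\<close> and \<open>rcells\<close> collect the addresses of
  all item and numeric memory cells ever written.
\<close>

record 'a state =
  nreg :: "nat \<Rightarrow> nat"
  rreg :: "nat \<Rightarrow> real"
  imem :: "nat \<Rightarrow> 'a option"
  rmem :: "nat \<Rightarrow> real"
  cur :: "'a option"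
  icells :: "nat set"
  rcells :: "nat set"
  queries :: nat
  passes :: nat
  time :: nat

fun nval :: "'a state \<Rightarrow> nexp \<Rightarrow> nat" where
  "nval s (NConst k) = k"
| "nval s (NReg i) = nreg s i"
| "nval s (NAdd a b) = nval s a + nval s b"
| "nval s (NSub a b) = nval s a - nval s b"
| "nval s (NHalf a) = nval s a div 2"

fun ival :: "'a state \<Rightarrow> iref \<Rightarrow> 'a option" where
  "ival s Cur = cur s"
| "ival s (Cell a) = imem s (nval s a)"

fun rval :: "('a \<Rightarrow> real) \<Rightarrow> 'a state \<Rightarrow> rexp \<Rightarrow> real" where
  "rval c s (RConst k) = of_int k"
| "rval c s (RReg i) = rreg s i"
| "rval c s (RMem a) = rmem s (nval s a)"
| "rval c s (ROfNat a) = of_nat (nval s a)"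
| "rval c s (RCost x) = (case ival s x of None \<Rightarrow> 0 | Some e \<Rightarrow> c e)"
| "rval c s (RAdd a b) = rval c s a + rval c s b"
| "rval c s (RSub a b) = rval c s a - rval c s b"
| "rval c s (RMul a b) = rval c s a * rval c s b"
| "rval c s (RDiv a b) = rval c s a / rval c s b"

fun bval :: "('a \<Rightarrow> real) \<Rightarrow> 'a state \<Rightarrow> bexp \<Rightarrow> bool" where
  "bval c s (NLess a b) \<longleftrightarrow> nval s a < nval s b"
| "bval c s (RLess a b) \<longleftrightarrow> rval c s a < rval c s b"
| "bval c s (BNot p) \<longleftrightarrow> \<not> bval c s p"
| "bval c s (BAnd p q) \<longleftrightarrow> bval c s p \<and> bval c s q"

definition items_in :: "'a state \<Rightarrow> nat \<Rightarrow> nat \<Rightarrow> 'a set" where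
  "items_in s a b = {e. \<exists>i. a \<le> i \<and> i < b \<and> imem s i = Some e}"

definition query_set :: "'a state \<Rightarrow> nexp \<Rightarrow> nexp \<Rightarrow> iref list \<Rightarrow> 'a set" where
  "query_set s a b xs = items_in s (nval s a) (nval s b) \<union> {e. \<exists>x\<in>set xs. ival s x = Some e}"

definition tick :: "'a state \<Rightarrow> 'a state" where
  "tick s = s\<lparr>time := time s + 1\<rparr>"

text \<open>
  Unit time is charged for each register assignment, memory write, oracle call, loop iteration and
  item read from the stream. Branching and failing loop tests are not charged: in a fixed program
  only boundedly many of them, each with expressions of bounded size, can occur between two
  charged steps.
\<close>

inductive exec :: "('a set \<Rightarrow> real) \<Rightarrow> ('a \<Rightarrow> real) \<Rightarrow> com \<Rightarrow> 'a state \<Rightarrow> 'a state \<Rightarrow> bool"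
  for f c where
  Skip: "exec f c Skip s s"
| NSet: "exec f c (NSet r a) s (tick (s\<lparr>nreg := (nreg s)(r := nval s a)\<rparr>))"
| RSet: "exec f c (RSet r x) s (tick (s\<lparr>rreg := (rreg s)(r := rval c s x)\<rparr>))"
| RStore: "exec f c (RStore a x) s
    (tick (s\<lparr>rmem := (rmem s)(nval s a := rval c s x), rcells := insert (nval s a) (rcells s)\<rparr>))"
| IStore: "exec f c (IStore a x) s
    (tick (s\<lparr>imem := (imem s)(nval s a := ival s x), icells := insert (nval s a) (icells s)\<rparr>))"
| Query: "exec f c (Query r a b xs) s
    (tick (s\<lparr>rreg := (rreg s)(r := f (query_set s a b xs)), queries := queries s + 1\<rparr>))"
| Seq: "exec f c p s t \<Longrightarrow> exec f c q t u \<Longrightarrow> exec f c (Seq p q) s u"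
| CondTrue: "bval c s b \<Longrightarrow> exec f c p s t \<Longrightarrow> exec f c (Cond b p q) s t"
| CondFalse: "\<not> bval c s b \<Longrightarrow> exec f c q s t \<Longrightarrow> exec f c (Cond b p q) s t"
| WhileFalse: "\<not> bval c s b \<Longrightarrow> exec f c (While b p) s s"
| WhileTrue: "bval c s b \<Longrightarrow> exec f c p (tick s) t \<Longrightarrow> exec f c (While b p) t u \<Longrightarrow>
    exec f c (While b p) s u"

inductive scan ::
  "('a set \<Rightarrow> real) \<Rightarrow> ('a \<Rightarrow> real) \<Rightarrow> com \<Rightarrow> 'a list \<Rightarrow> 'a state \<Rightarrow> 'a state \<Rightarrow> bool"
  for f c p where
  Nil: "scan f c p [] s (s\<lparr>cur := None\<rparr>)"
| Cons: "exec f c p (tick (s\<lparr>cur := Some e\<rparr>)) t \<Longrightarrow> scan f c p es t u \<Longrightarrow> scan f c p (e # es) s u"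

inductive run ::
  "('a set \<Rightarrow> real) \<Rightarrow> ('a \<Rightarrow> real) \<Rightarrow> 'a list \<Rightarrow> prog \<Rightarrow> 'a state \<Rightarrow> 'a state \<Rightarrow> bool"
  for f c es where
  Local: "exec f c p s t \<Longrightarrow> run f c es (Local p) s t"
| Pass: "scan f c p es (s\<lparr>passes := passes s + 1\<rparr>) t \<Longrightarrow> run f c es (Pass p) s t"
| PSeq: "run f c es p s t \<Longrightarrow> run f c es q t u \<Longrightarrow> run f c es (PSeq p q) s u"
| PCondTrue: "bval c s b \<Longrightarrow> run f c es p s t \<Longrightarrow> run f c es (PCond b p q) s t"
| PCondFalse: "\<not> bval c s b \<Longrightarrow> run f c es q s t \<Longrightarrow> run f c es (PCond b p q) s t"
| PWhileFalse: "\<not> bval c s b \<Longrightarrow> run f c es (PWhile b p) s s"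
| PWhileTrue: "bval c s b \<Longrightarrow> run f c es p (tick s) t \<Longrightarrow> run f c es (PWhile b p) t u \<Longrightarrow>
    run f c es (PWhile b p) s u"

text \<open>
  The input consists of \<open>K\<close> and \<open>\<epsilon>\<close>, in real registers 0 and 1; in particular the length of
  the stream is not given. The output is the set of items in the first \<open>k\<close> item cells, where \<open>k\<close>
  is the final content of natural-number register 0.
\<close>

definition init_state :: "real \<Rightarrow> real \<Rightarrow> 'a state" where
  "init_state K \<epsilon> =
     \<lparr>nreg = (\<lambda>_. 0), rreg = (\<lambda>_. 0)(0 := K, 1 := \<epsilon>), imem = (\<lambda>_. None), rmem = (\<lambda>_. 0),
      cur = None, icells = {}, rcells = {}, queries = 0, passes = 0, time = 0\<rparr>"

definition output_set :: "'a state \<Rightarrow> 'a set" where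
  "output_set s = items_in s 0 (nreg s 0)"

text \<open>
  Numeric memory cells are counted too; since \<open>icells\<close> never shrinks, \<open>space\<close> of a final state
  bounds the number of items stored at any moment of the run.
\<close>

definition space :: "'a state \<Rightarrow> nat" where
  "space s = card (icells s) + card (rcells s)"


section \<open>Runs are deterministic\<close>

lemma exec_deterministic: "exec f c p s t \<Longrightarrow> exec f c p s t' \<Longrightarrow> t' = t"
proof (induction arbitrary: t' rule: exec.induct)
  case (WhileTrue s b p t u)
  from WhileTrue.prems WhileTrue.hyps(1) obtain v
    where "exec f c p (tick s) v" "exec f c (While b p) v t'"
    by (auto elim: exec.cases)
  with WhileTrue.IH show ?case by blast
next
  case (Seq p s t q u)
  from Seq.prems obtain v where "exec f c p s v" "exec f c q v t'"
    by (auto elim: exec.cases)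
  with Seq.IH show ?case by blast
qed (erule exec.cases; simp)+

lemma scan_deterministic: "scan f c p es s t \<Longrightarrow> scan f c p es s t' \<Longrightarrow> t' = t"
proof (induction arbitrary: t' rule: scan.induct)
  case (Cons e s t es u)
  from Cons.prems obtain v where "exec f c p (tick (s\<lparr>cur := Some e\<rparr>)) v" "scan f c p es v t'"
    by (auto elim: scan.cases)
  with Cons.IH Cons.hyps(1) show ?case by (metis exec_deterministic)
qed (erule scan.cases; simp)

lemma run_deterministic: "run f c es p s t \<Longrightarrow> run f c es p s t' \<Longrightarrow> t' = t"
proof (induction arbitrary: t' rule: run.induct)
  case (PWhileTrue s b p t u)
  from PWhileTrue.prems PWhileTrue.hyps(1) obtain v
    where "run f c es p (tick s) v" "run f c es (PWhile b p) v t'"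
    by (auto elim: run.cases)
  with PWhileTrue.IH show ?case by blast
next
  case (PSeq p s t q u)
  from PSeq.prems obtain v where "run f c es p s v" "run f c es q v t'"
    by (auto elim: run.cases)
  with PSeq.IH show ?case by blast
next
  case (Local p s t)
  then show ?case by (auto elim: run.cases intro: exec_deterministic)
next
  case (Pass p s t)
  from Pass.prems have "scan f c p es (s\<lparr>passes := passes s + 1\<rparr>) t'"
    by (cases rule: run.cases) simp_all
  with Pass.hyps show ?case by (rule scan_deterministic)
qed (erule run.cases; simp)+

end

theory Submission
  imports Defs
begin

text \<open>
  One pass determines \<open>f(OPT)\<close> up to a constant factor: an item is added to the current block
  if its density exceeds \<open>2 v / K\<close>, where \<open>v\<close> is the value of the previous block; a block that
  overflows has at least doubled \<open>v\<close> and is discarded, so the values of all discarded blocks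
  form a geometric series.

  The sieve then makes one pass for each threshold \<open>\<Lambda> / K * (1 / u - 1)\<close>, where
  \<open>f(OPT) \<le> \<Lambda> = O(f(OPT))\<close> and \<open>u = \<delta>, 2 \<delta>, 3 \<delta>, \<dots>\<close> with \<open>\<delta> = \<epsilon> / 2000\<close>. An item whose
  marginal density exceeds the threshold is added to \<open>T\<close>, and every feasible set \<open>T + e\<close> that
  is met is a candidate for the output. Let \<open>p\<close> be the most expensive item of OPT and
  \<open>x K = K - c(p)\<close>. While \<open>c(T) \<le> x K\<close> every item of OPT fits, and unless \<open>T + p\<close> is good
  enough, the rejected items of OPT force the threshold at which \<open>c(T)\<close> exceeds \<open>x K\<close> to be
  about \<open>f(OPT) / (2 x K)\<close>, whence \<open>f(T) \<ge> f(OPT) / 2 - O(\<delta> / x) f(OPT)\<close>. The spacing of the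
  thresholds is only additive in \<open>u\<close>, which makes this useless for small \<open>x\<close>; but then the items
  of OPT other than \<open>p\<close> still fit until \<open>c(T)\<close> exceeds \<open>K / 2\<close>. As long as \<open>T\<close> is not good enough
  they keep the thresholds above \<open>\<epsilon> f(OPT) / (2 x K)\<close>, so the additional cost of order \<open>K\<close>
  compensates the loss.
\<close>

section \<open>Approximation guarantee of the sieve\<close>

locale knapsack =
  fixes U :: "'a set" and es :: "'a list" and f :: "'a set \<Rightarrow> real" and c :: "'a \<Rightarrow> real" and K :: real
  assumes inst: "knapsack_instance U es f c K"
begin

lemma finite_U: "finite U" and distinct_es: "distinct es" and es_U: "set es \<subseteq> U" and K_pos: "0 < K"
  and cost_ge_1: "e \<in> set es \<Longrightarrow> 1 \<le> c e" and cost_le_K: "e \<in> set es \<Longrightarrow> c e \<le> K"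
  using inst by (auto simp: knapsack_instance_def)

lemma f_nonneg: "S \<subseteq> U \<Longrightarrow> 0 \<le> f S"
  and f_mono: "S \<subseteq> T \<Longrightarrow> T \<subseteq> U \<Longrightarrow> f S \<le> f T"
  and f_submodular:
    "S \<subseteq> T \<Longrightarrow> T \<subseteq> U \<Longrightarrow> e \<in> U \<Longrightarrow> f (insert e T) - f T \<le> f (insert e S) - f S"
  using inst by (auto simp: knapsack_instance_def monotone_submodular_def)

lemma f_insert_le: "S \<subseteq> U \<Longrightarrow> e \<in> U \<Longrightarrow> f (insert e S) \<le> f S + f {e}"
  using f_submodular[of "{}" S e] f_nonneg[of "{}"] by auto

text \<open>Insert the items of \<open>A\<close> one at a time: by submodularity each marginal gain
  is at most the gain with respect to \<open>S\<close> alone.\<close>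

lemma f_union_le:
  assumes "A \<subseteq> U" "S \<subseteq> U" "\<And>a. a \<in> A \<Longrightarrow> f (insert a S) - f S \<le> t * c a"
  shows "f (S \<union> A) \<le> f S + t * sum c A"
proof -
  have "finite A" using assms(1) finite_U finite_subset by blast
  then show ?thesis using assms(1,3)
  proof (induction A rule: finite_induct)
    case (insert a A)
    have "f (insert a (S \<union> A)) - f (S \<union> A) \<le> f (insert a S) - f S"
      using insert.prems assms(2) by (intro f_submodular) auto
    also have "\<dots> \<le> t * c a" using insert.prems by auto
    finally show ?case using insert by (auto simp: algebra_simps)
  qed simp
qed

lemma length_le_cost: "set T \<subseteq> set es \<Longrightarrow> real (length T) \<le> sum_list (map c T)"
  using cost_ge_1 by (induction T) (fastforce)+

text \<open>\<open>T j\<close> stands for the set after pass \<open>j\<close>. The index shift in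
  \<open>candidate\<close> arises because \<open>e\<close> is tested at some moment of pass
  \<open>j + 1\<close>, against a set between \<open>T j\<close> and \<open>T (Suc j)\<close>; it
  certainly fits at that moment if it fits with \<open>T (Suc j)\<close>.\<close>

lemma approximation_of_sieve:
  fixes T :: "nat \<Rightarrow> 'a set" and \<tau> :: "nat \<Rightarrow> real"
  assumes eps: "0 < \<epsilon>" "\<epsilon> < 1 / 2" and \<delta>: "\<delta> = \<epsilon> / 2000"
    and opt: "Opt \<subseteq> set es" "sum c Opt \<le> K" "0 < f Opt"
    and \<Lambda>: "f Opt \<le> \<Lambda>" "\<Lambda> \<le> 12 * f Opt"
    and \<tau>: "\<And>j. \<tau> j = \<Lambda> / K * (1 / (real j * \<delta>) - 1)"
    and J: "(real J + 1) * \<delta> < 1" "1 \<le> (real J + 2) * \<delta>"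
    and T0: "T 0 = {}" and T: "\<And>j. j \<le> J \<Longrightarrow> T j \<subseteq> set es"
    and gain: "\<And>j. j < J \<Longrightarrow>
      \<tau> (Suc j) * (sum c (T (Suc j)) - sum c (T j)) \<le> f (T (Suc j)) - f (T j)"
    and cost_mono: "\<And>j. j < J \<Longrightarrow> sum c (T j) \<le> sum c (T (Suc j))"
    and rejected: "\<And>j e. 1 \<le> j \<Longrightarrow> j \<le> J \<Longrightarrow> e \<in> set es \<Longrightarrow> sum c (T j) + c e \<le> K \<Longrightarrow>
      f (insert e (T j)) - f (T j) \<le> \<tau> j * c e"
    and candidate: "\<And>j e. j < J \<Longrightarrow> e \<in> set es \<Longrightarrow> sum c (T (Suc j)) + c e \<le> K \<Longrightarrow>
      f (insert e (T j)) \<le> best"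
    and singleton: "\<And>e. e \<in> set es \<Longrightarrow> f {e} \<le> best"
    and T_best: "\<And>j. j \<le> J \<Longrightarrow> f (T j) \<le> best" and best: "0 \<le> best"
  shows "(1 / 2 - \<epsilon>) * f Opt \<le> best"
proof (rule ccontr)
  assume contra: "\<not> ?thesis"
  define W where "W = f Opt"
  have low: "best < (1/2 - \<epsilon>) * W" and W: "0 < W" "W \<le> \<Lambda>" "\<Lambda> \<le> 12 * W"
    using contra opt \<Lambda> by (auto simp: W_def)
  have K: "0 < K" by (rule K_pos)
  have d: "0 < \<delta>" "\<delta> < 1 / 4000" using eps \<delta> by auto
  have finO: "finite Opt" using opt(1) finite_subset by blast
  have epsW: "0 < \<epsilon> * W" using eps W by simp
  have low2: "best < W / 2" using low epsW by (simp add: algebra_simps)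
  \<comment> \<open>\<open>f {}\<close> may be positive, so \<open>0 < f Opt\<close> alone does not
    exclude an empty optimum; but then \<open>best\<close> would already reach
    \<open>f {}\<close>.\<close>
  have "Opt \<noteq> {}"
  proof
    assume "Opt = {}"
    then have "0 < f {}" using opt by auto
    show False
    proof (cases "es = []")
      case True
      have "f (T 0) \<le> best" using T_best by blast
      then show False using T0 \<open>Opt = {}\<close> low2 W by (simp add: W_def)
    next
      case False
      then obtain e where e: "e \<in> set es" by (cases es) auto
      have "f {} \<le> f {e}" using e es_U by (intro f_mono) auto
      then show False using singleton[OF e] low2 W \<open>Opt = {}\<close> by (simp add: W_def)
    qed
  qed
  then have "Max (c ` Opt) \<in> c ` Opt" using finO by simp
  then obtain p where p: "p \<in> Opt" and "c p = Max (c ` Opt)" by (metis imageE)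
  then have pmax: "c e \<le> c p" if "e \<in> Opt" for e using that finO by simp
  define R where "R = Opt - {p}"
  have pE: "p \<in> set es" and RE: "R \<subseteq> set es" and Opt: "Opt = insert p R" and pR: "p \<notin> R"
    and finR: "finite R"
    using p opt finO by (auto simp: R_def)
  define X where "X = K - c p"
  define x where "x = X / K"
  have XK: "X = x * K" using K by (simp add: x_def)
  have costR: "sum c R \<le> X" using opt(2) Opt pR finR by (simp add: X_def)
  have R_nonneg: "0 \<le> c e" if "e \<in> R" for e using cost_ge_1[of e] that RE by force
  have small: "c e \<le> X" "c e \<le> c p" if "e \<in> R" for e
    using member_le_sum[of e R c] that R_nonneg finR costR pmax Opt by auto
  \<comment> \<open>Otherwise \<open>p\<close> on its own would be good enough, by
    subadditivity.\<close>
  have fR: "(1/2 + \<epsilon>) * W < f R"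
  proof -
    have "f Opt \<le> f R + f {p}" unfolding Opt using RE pE es_U by (intro f_insert_le) auto
    then show ?thesis using singleton[OF pE] low unfolding W_def by (simp add: algebra_simps)
  qed
  have "R \<noteq> {}"
  proof
    assume "R = {}"
    then have "f R \<le> f {p}" using pE es_U by (intro f_mono) auto
    then show False using fR singleton[OF pE] low2 epsW by (simp add: algebra_simps)
  qed
  then obtain r where "r \<in> R" by blast
  then have X1: "1 \<le> X" using small(1)[of r] cost_ge_1[of r] RE by force
  have x: "0 < x" "x < 1" using X1 K cost_ge_1[OF pE] by (auto simp: x_def X_def)
  have TU: "T j \<subseteq> U" if "j \<le> J" for j using T[OF that] es_U by auto
  have RU: "R \<subseteq> U" using RE es_U by auto
  have J_pos: "1 \<le> J" using J(2) d by (cases J) auto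
  have J1: "real J * \<delta> + \<delta> < 1" "1 \<le> real J * \<delta> + 2 * \<delta>"
    using J by (simp_all add: algebra_simps)
  have \<tau>_mono: "\<tau> j \<le> \<tau> i" if "1 \<le> i" "i \<le> j" for i j
  proof -
    have "1 / (real j * \<delta>) \<le> 1 / (real i * \<delta>)"
      using that d by (intro divide_left_mono) auto
    then show ?thesis unfolding \<tau> using W K by (intro mult_left_mono) auto
  qed
  have \<tau>_nonneg: "0 \<le> \<tau> j" if "1 \<le> j" "j \<le> J" for j
  proof -
    have "real j * \<delta> \<le> real J * \<delta>" using that d by simp
    then have "real j * \<delta> \<le> 1" using J1(1) d by linarith
    then show ?thesis unfolding \<tau> using W K that d by (auto simp: field_simps)
  qed
  \<comment> \<open>All items of \<open>R\<close> still fit, so those missing from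
    \<open>T j\<close> were rejected for their density and not for their cost.\<close>
  have residual: "f R \<le> f (T j) + \<tau> j * X"
    if "1 \<le> j" "j \<le> J" "\<And>e. e \<in> R \<Longrightarrow> sum c (T j) + c e \<le> K" for j
  proof -
    have "f R \<le> f (T j \<union> R)" using TU that(2) RU by (intro f_mono) auto
    also have "\<dots> \<le> f (T j) + \<tau> j * sum c R"
      using RU TU that RE by (intro f_union_le rejected) auto
    also have "\<dots> \<le> f (T j) + \<tau> j * X" using costR \<tau>_nonneg that by (simp add: mult_left_mono)
    finally show ?thesis .
  qed
  have \<tau>_lower: "2 * \<epsilon> * W < \<tau> j * X"
    if "1 \<le> j" "j \<le> J" "\<And>e. e \<in> R \<Longrightarrow> sum c (T j) + c e \<le> K" for j
    using residual[OF that] T_best[OF that(2)] fR low by (simp add: algebra_simps)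
  \<comment> \<open>The last position is at least \<open>1 - 2 * \<delta>\<close>, so \<open>\<tau>
    J * K \<le> 4 * \<delta> * \<Lambda> \<le> 48 * \<delta> * W\<close>, too small to cover the gap
    \<open>2 * \<epsilon> * W\<close> between \<open>f R\<close> and \<open>f (T J)\<close>.\<close>
  have last: "\<exists>e\<in>R. K < sum c (T J) + c e"
  proof (rule ccontr)
    assume "\<not> ?thesis"
    then have "2 * \<epsilon> * W < \<tau> J * X" using J_pos by (intro \<tau>_lower) auto
    also have "\<tau> J * X = \<Lambda> * (1 / (real J * \<delta>) - 1) * x" unfolding \<tau> using K by (simp add: XK)
    also have "\<dots> \<le> \<Lambda> * (4 * \<delta>) * 1"
    proof (intro mult_mono)
      have u: "1 - 2 * \<delta> \<le> real J * \<delta>" using J1(2) by linarith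
      have "1 / (real J * \<delta>) \<le> 1 / (1 - 2 * \<delta>)" using u d J_pos by (intro divide_left_mono) auto
      also have "\<dots> \<le> 1 + 4 * \<delta>" using d by (simp add: field_simps)
      finally show "1 / (real J * \<delta>) - 1 \<le> 4 * \<delta>" by simp
    next
      have "real J * \<delta> \<le> 1" "0 < real J * \<delta>" using J1 d J_pos by auto
      then show "0 \<le> 1 / (real J * \<delta>) - 1" by simp
    qed (use x W d in auto)
    also have "\<dots> \<le> 12 * W * (4 * \<delta>)" using W d by simp
    finally show False using W eps by (simp add: \<delta>)
  qed
  \<comment> \<open>The thresholds decrease, so all of the cost of \<open>T j\<close> was bought at
    density at least \<open>\<tau> j\<close>.\<close>
  have gain0: "\<tau> j * sum c (T j) \<le> f (T j)" if "1 \<le> j" "j \<le> J" for j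
    using that
  proof (induction j rule: dec_induct)
    case base
    then show ?case using gain[of 0] J_pos T0 f_nonneg[of "{}"] by simp
  next
    case (step j)
    have "0 \<le> sum c (T j)" using T[of j] step cost_ge_1
      by (intro sum_nonneg) (meson Suc_leD order_trans subsetD zero_le_one)
    then have "\<tau> (Suc j) * sum c (T j) \<le> \<tau> j * sum c (T j)"
      using \<tau>_mono[of j "Suc j"] step by (intro mult_right_mono) auto
    then show ?case using gain[of j] step by (simp add: algebra_simps)
  qed
  have gain2: "\<tau> b * (sum c (T b) - sum c (T a)) \<le> f (T b) - f (T a)"
    if "1 \<le> a" "a \<le> b" "b \<le> J" for a b
    using that(2,3)
  proof (induction b rule: dec_induct)
    case (step b)
    have "sum c (T a) \<le> sum c (T b)"
      using step.hyps(1) step.prems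
    proof (induction b rule: dec_induct)
      case (step k) then show ?case using cost_mono[of k] by auto
    qed simp
    then have "\<tau> (Suc b) * (sum c (T b) - sum c (T a)) \<le> \<tau> b * (sum c (T b) - sum c (T a))"
      using \<tau>_mono[of b "Suc b"] step that by (intro mult_right_mono) auto
    then show ?case using gain[of b] step by (simp add: algebra_simps)
  qed simp
  have "\<exists>j\<le>J. X < sum c (T j)"
  proof -
    obtain e where "e \<in> R" "K < sum c (T J) + c e" using last by blast
    then have "X < sum c (T J)" using small(2)[of e] by (simp add: X_def)
    then show ?thesis by blast
  qed
  \<comment> \<open>The first pass after which \<open>p\<close> no longer fits; it exists because
    \<open>p\<close> costs at least as much as the item found in \<open>last\<close>.\<close>
  define a where "a = (LEAST j. X < sum c (T j))"
  have a: "X < sum c (T a)" unfolding a_def by (rule LeastI_ex) (use \<open>\<exists>j\<le>J. _\<close> in blast)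
  have aJ: "a \<le> J" using \<open>\<exists>j\<le>J. _\<close> Least_le[of "\<lambda>j. X < sum c (T j)"] unfolding a_def
    by (meson order_trans)
  have before_a: "sum c (T j) \<le> X" if "j < a" for j
    using not_less_Least[of j "\<lambda>j. X < sum c (T j)"] that by (simp add: a_def not_less)
  have a1: "1 \<le> a" using a T0 X1 by (cases a) auto
  \<comment> \<open>Two passes before \<open>a\<close> the threshold times \<open>X\<close> is still
    at least \<open>W / 2\<close>; two spacings of \<open>u\<close> lose at most
    \<open>162 * \<delta> * W / x\<close>.\<close>
  have bound_a: "W / 2 - 162 * \<delta> * W / x \<le> \<tau> a * X"
  proof (cases "\<tau> a * X < W / 2")
    case True
    define u where "u = real a * \<delta>"
    have u: "0 < u" using a1 d by (simp add: u_def)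
    have ux: "2 * x / 3 < u"
    proof -
      have "\<tau> a * X = \<Lambda> * ((1 / u - 1) * x)" unfolding \<tau> u_def using K by (simp add: XK)
      moreover have nn: "0 \<le> (1 / u - 1) * x"
        using \<tau>_nonneg[OF a1 aJ] W K x unfolding \<tau> u_def[symmetric] by (simp add: zero_le_mult_iff zero_le_divide_iff)
      ultimately have "W * ((1 / u - 1) * x) < W / 2"
        using True mult_right_mono[OF W(2) nn] by linarith
      then have "(1 / u - 1) * x < 1 / 2" using W by simp
      then have "(1 - u) * x < u / 2" using u by (simp add: field_simps)
      then have "x < u * (1 / 2 + x)" by (simp add: algebra_simps)
      also have "\<dots> < u * (3 / 2)" using x u by simp
      finally show ?thesis by simp
    qed
    show ?thesis
    proof (cases "a \<le> 2")
      case True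
      \<comment> \<open>With no earlier pass to fall back on, \<open>x\<close> is so small that the
        claimed lower bound is negative.\<close>
      then have "u \<le> 2 * \<delta>" using d by (simp add: u_def)
      then have "x < 3 * \<delta>" using ux by simp
      then have "W / 2 \<le> 162 * \<delta> * W / x" using x W d by (simp add: field_simps)
      moreover have "0 \<le> \<tau> a * X" using \<tau>_nonneg[OF a1 aJ] X1 by simp
      ultimately show ?thesis by linarith
    next
      case False
      \<comment> \<open>Two passes back instead of one: \<open>candidate\<close> for
        \<open>T k\<close> requires that \<open>p\<close> fits with \<open>T (Suc k)\<close>, and
        \<open>a - 1\<close> is the last index before \<open>a\<close>.\<close>
      define k where "k = a - 2"
      have k: "a = k + 2" "1 \<le> k" using False by (auto simp: k_def)
      have fits: "sum c (T j) + c e \<le> K" if "j < a" "e \<in> Opt" for j e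
        using before_a[OF that(1)] pmax[OF that(2)] by (simp add: X_def)
      have "f (insert p (T k)) \<le> best"
        using candidate[of k p] fits[of "Suc k" p] k aJ pE p by auto
      moreover have "f Opt \<le> f (insert p (T k) \<union> R)"
        unfolding Opt using TU[of k] k aJ RU pE es_U by (intro f_mono) auto
      moreover have "f (insert p (T k) \<union> R) \<le> f (insert p (T k)) + \<tau> k * sum c R"
      proof (intro f_union_le)
        fix e assume e: "e \<in> R"
        have "f (insert e (insert p (T k))) - f (insert p (T k)) \<le> f (insert e (T k)) - f (T k)"
          using TU[of k] k aJ e RU pE es_U by (intro f_submodular) auto
        also have "\<dots> \<le> \<tau> k * c e" using fits[of k e] e Opt k aJ RE by (intro rejected) auto
        finally show "f (insert e (insert p (T k))) - f (insert p (T k)) \<le> \<tau> k * c e" .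
      qed (use TU[of k] k aJ RU pE es_U in auto)
      moreover have "\<tau> k * sum c R \<le> \<tau> k * X"
        using costR \<tau>_nonneg[of k] k aJ by (intro mult_left_mono) auto
      ultimately have big: "W / 2 \<le> \<tau> k * X" using low2 by (simp add: W_def)
      \<comment> \<open>The factor 6 is \<open>2 * 3\<close>: the positions differ by
        \<open>2 * \<delta>\<close>, and \<open>u \<le> 3 * w\<close> because
        \<open>k \<ge> 1\<close>.\<close>
      have diff: "\<tau> k - \<tau> a \<le> \<Lambda> / K * (6 * \<delta> / u\<^sup>2)"
      proof -
        define w where "w = real k * \<delta>"
        have w: "0 < w" "u = w + 2 * \<delta>" "u \<le> 3 * w" using k d by (auto simp: w_def u_def algebra_simps)
        have "1 / w - 1 / u = 2 * \<delta> / (w * u)" using w u by (simp add: field_simps)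
        also have "\<dots> = 6 * \<delta> / ((3 * w) * u)" by simp
        also have "\<dots> \<le> 6 * \<delta> / (u * u)" using w u d
          by (intro divide_left_mono mult_right_mono) auto
        finally have "1 / w - 1 / u \<le> 6 * \<delta> / u\<^sup>2" by (simp add: power2_eq_square)
        then have "\<Lambda> / K * (1 / w - 1 / u) \<le> \<Lambda> / K * (6 * \<delta> / u\<^sup>2)"
          using W K by (intro mult_left_mono) auto
        then show ?thesis unfolding \<tau> w_def u_def by (simp add: algebra_simps)
      qed
      have "(\<tau> k - \<tau> a) * X \<le> \<Lambda> / K * (6 * \<delta> / u\<^sup>2) * X"
        using diff X1 by (intro mult_right_mono) auto
      also have "\<dots> = \<Lambda> * (6 * \<delta> / u\<^sup>2 * x)" using K by (simp add: XK)
      \<comment> \<open>Here \<open>\<Lambda> \<le> 12 * W\<close> and \<open>u > 2 * x / 3\<close>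
        enter; \<open>12 * 6 * (3 / 2)\<^sup>2 = 162\<close>.\<close>
      also have "\<dots> \<le> 12 * W * (6 * \<delta> / (2 * x / 3)\<^sup>2 * x)"
        using W d x u ux by (intro mult_mono divide_left_mono power_mono) auto
      also have "\<dots> = 162 * \<delta> * W / x" using x by (simp add: field_simps power2_eq_square)
      finally show ?thesis using big unfolding left_diff_distrib by linarith
    qed
  next
    case False
    have "0 \<le> 162 * \<delta> * W / x" using d W x by simp
    then show ?thesis using False by linarith
  qed
  have fa: "\<tau> a * X \<le> f (T a)"
    using gain0[OF a1 aJ] mult_left_mono[OF less_imp_le[OF a] \<tau>_nonneg[OF a1 aJ]] by linarith
  show False
  proof (cases "1 / 8 \<le> x")
    case True
    have "162 * \<delta> * W / x \<le> 162 * \<delta> * W / (1 / 8)"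
      using True d W x by (intro divide_left_mono) auto
    \<comment> \<open>\<open>8 * 162 = 1296\<close> is below the 2000 in
      \<open>\<delta> = \<epsilon> / 2000\<close>.\<close>
    also have "\<dots> \<le> \<epsilon> * W" using eps W by (simp add: \<delta>)
    finally show False using bound_a fa T_best[OF aJ] low unfolding left_diff_distrib by linarith
  next
    case False
    have fits: "sum c (T j) + c e \<le> K" if "sum c (T j) \<le> K / 2" "e \<in> R" for j e
    proof -
      have "X < K / 8" using False K by (simp add: x_def field_simps)
      then show ?thesis using that small(1)[of e] K by simp
    qed
    have ex_b: "\<exists>j\<le>J. K / 2 < sum c (T j)"
      using last fits by (meson not_less order_refl)
    \<comment> \<open>For small \<open>x\<close> each item of \<open>R\<close> fits until more than
      half of the budget is spent, so \<open>\<tau>_lower\<close> applies to every pass from the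
      first up to \<open>b - 1\<close>.\<close>
    define b where "b = (LEAST j. K / 2 < sum c (T j))"
    have b: "K / 2 < sum c (T b)" unfolding b_def by (rule LeastI_ex) (use ex_b in blast)
    have bJ: "b \<le> J" using ex_b Least_le[of "\<lambda>j. K / 2 < sum c (T j)"] unfolding b_def
      by (meson order_trans)
    have before_b: "sum c (T j) \<le> K / 2" if "j < b" for j
      using not_less_Least[of j "\<lambda>j. K / 2 < sum c (T j)"] that by (simp add: b_def not_less)
    have XK2: "X < K / 8" using False K by (simp add: x_def field_simps)
    have ab: "a \<le> b" using before_b b XK2 unfolding a_def by (intro Least_le) (use K in auto)
    \<comment> \<open>A first pass that spends \<open>K / 2\<close> at a threshold of at least
      \<open>\<Lambda> / K\<close> would already gain \<open>W / 2\<close>.\<close>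
    have b2: "2 \<le> b"
    proof (rule ccontr)
      assume "\<not> 2 \<le> b"
      then have "b = 1" using ab a1 by simp
      have "1 \<le> 1 / \<delta> - 1" using d by (simp add: field_simps)
      then have "\<Lambda> / K * 1 \<le> \<tau> 1" unfolding \<tau> using W K by (intro mult_left_mono) auto
      then have "\<Lambda> / K * (K / 2) \<le> \<tau> 1 * sum c (T 1)"
        using b \<open>b = 1\<close> W K \<tau>_nonneg[of 1] J_pos by (intro mult_mono) auto
      also have "\<dots> \<le> f (T 1)" using gain0 J_pos by simp
      finally show False using T_best[OF J_pos] low2 W K by simp
    qed
    define k where "k = b - 1"
    have k: "b = Suc k" "1 \<le> k" using b2 by (auto simp: k_def)
    have "2 * \<epsilon> * W < \<tau> k * X" using k bJ fits before_b by (intro \<tau>_lower) auto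
    \<comment> \<open>Each factor of \<open>(1 - w) / w\<close> changes by at most 2 when
      \<open>w\<close> grows by \<open>\<delta>\<close>: the denominator since
      \<open>\<delta> \<le> w\<close>, the numerator since \<open>b \<le> J\<close> leaves
      \<open>w + 2 * \<delta> < 1\<close>.\<close>
    moreover have \<tau>kb: "\<tau> k \<le> 4 * \<tau> b"
    proof -
      define w where "w = real k * \<delta>"
      have w: "\<delta> \<le> w" "real b * \<delta> = w + \<delta>" "w + 2 * \<delta> < 1"
      proof -
        show "\<delta> \<le> w" "real b * \<delta> = w + \<delta>" using k d by (auto simp: w_def algebra_simps)
        have "real b * \<delta> \<le> real J * \<delta>" using bJ d by simp
        then show "w + 2 * \<delta> < 1" using J1(1) \<open>real b * \<delta> = w + \<delta>\<close> by linarith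
      qed
      have "1 / w - 1 = (1 - w) / w" using w d by (simp add: field_simps)
      also have "\<dots> \<le> (2 * (1 - (w + \<delta>))) / w" using w d by (intro divide_right_mono) auto
      also have "\<dots> = (4 * (1 - (w + \<delta>))) / (2 * w)" using w d by (simp add: field_simps)
      also have "\<dots> \<le> (4 * (1 - (w + \<delta>))) / (w + \<delta>)" using w d by (intro divide_left_mono) auto
      also have "\<dots> = 4 * (1 / (w + \<delta>) - 1)" using w d by (simp add: field_simps)
      finally have "\<Lambda> / K * (1 / w - 1) \<le> \<Lambda> / K * (4 * (1 / (w + \<delta>) - 1))"
        using W K by (intro mult_left_mono) auto
      then show ?thesis unfolding \<tau> w(2) w_def[symmetric] mult.left_commute[of "\<Lambda> / K" 4] .
    qed
    ultimately have "2 * \<epsilon> * W < 4 * \<tau> b * X" using mult_right_mono[OF \<tau>kb, of X] X1 by linarith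
    then have "\<epsilon> * W / 2 < \<tau> b * x * K" by (simp add: XK mult_ac)
    then have tb: "\<epsilon> * W / (2 * x) < \<tau> b * K" using x by (simp add: field_simps)
    have "\<tau> b * (3 / 8 * K) \<le> \<tau> b * (sum c (T b) - X)"
      using b XK2 \<tau>_nonneg[of b] bJ b2 by (intro mult_left_mono) auto
    \<comment> \<open>The cost of \<open>T b\<close> is charged at density \<open>\<tau> a\<close>
      up to \<open>X\<close> and at density \<open>\<tau> b\<close> beyond it; the part of
      \<open>T a\<close> above \<open>X\<close> is thus charged at the lower rate.\<close>
    moreover have "\<tau> b * (sum c (T a) - X) \<le> \<tau> a * (sum c (T a) - X)"
      using \<tau>_mono[OF a1 ab] a by (intro mult_right_mono) auto
    ultimately have "\<tau> a * X + \<tau> b * (3 / 8 * K) \<le> f (T b)"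
      using gain2[OF a1 ab bJ] gain0[OF a1 aJ] by (simp add: algebra_simps)
    then have "W / 2 - 162 * \<delta> * W / x + 3 / 8 * (\<epsilon> * W / (2 * x)) < f (T b)"
      using bound_a tb by linarith
    \<comment> \<open>Both sides are multiples of \<open>\<epsilon> * W / x\<close>, with factors
      \<open>162 / 2000\<close> and \<open>3 / 16\<close>.\<close>
    moreover have "162 * \<delta> * W / x \<le> 3 / 8 * (\<epsilon> * W / (2 * x))"
      using x W eps by (simp add: \<delta> field_simps)
    ultimately show False using T_best[OF bJ] low2 by linarith
  qed
qed

end

section \<open>The program\<close>

fun loop_free :: "com \<Rightarrow> bool" where
  "loop_free (Seq p q) \<longleftrightarrow> loop_free p \<and> loop_free q"
| "loop_free (Cond b p q) \<longleftrightarrow> loop_free p \<and> loop_free q"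
| "loop_free (While b p) \<longleftrightarrow> False"
| "loop_free _ \<longleftrightarrow> True"

text \<open>The clause for \<open>While\<close> is a dummy value; \<open>loop_free\<close> excludes
  that case wherever the function is compared with \<open>exec\<close>.\<close>

fun eval_com :: "('a set \<Rightarrow> real) \<Rightarrow> ('a \<Rightarrow> real) \<Rightarrow> com \<Rightarrow> 'a state \<Rightarrow> 'a state" where
  "eval_com f c Skip s = s"
| "eval_com f c (NSet r a) s = tick (s\<lparr>nreg := (nreg s)(r := nval s a)\<rparr>)"
| "eval_com f c (RSet r x) s = tick (s\<lparr>rreg := (rreg s)(r := rval c s x)\<rparr>)"
| "eval_com f c (RStore a x) s = tick (s\<lparr>rmem := (rmem s)(nval s a := rval c s x),
    rcells := insert (nval s a) (rcells s)\<rparr>)"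
| "eval_com f c (IStore a x) s = tick (s\<lparr>imem := (imem s)(nval s a := ival s x),
    icells := insert (nval s a) (icells s)\<rparr>)"
| "eval_com f c (Query r a b xs) s =
    tick (s\<lparr>rreg := (rreg s)(r := f (query_set s a b xs)), queries := queries s + 1\<rparr>)"
| "eval_com f c (Seq p q) s = eval_com f c q (eval_com f c p s)"
| "eval_com f c (Cond b p q) s = (if bval c s b then eval_com f c p s else eval_com f c q s)"
| "eval_com f c (While b p) s = s"

lemma exec_eval_com: "loop_free p \<Longrightarrow> exec f c p s (eval_com f c p s)"
  by (induction p arbitrary: s) (auto intro: exec.intros exec.Query[simplified])

definition scan_step :: "('a set \<Rightarrow> real) \<Rightarrow> ('a \<Rightarrow> real) \<Rightarrow> com \<Rightarrow> 'a state \<Rightarrow> 'a \<Rightarrow> 'a state" where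
  "scan_step f c p s e = eval_com f c p (tick (s\<lparr>cur := Some e\<rparr>))"

text \<open>A pass with a loop-free body is a left fold, so its invariants can be proved by
  appending items to the part of the stream already read.\<close>

lemma scan_foldl:
  "loop_free p \<Longrightarrow> scan f c p xs s ((foldl (scan_step f c p) s xs)\<lparr>cur := None\<rparr>)"
  by (induction xs arbitrary: s) (auto intro: scan.intros exec_eval_com simp: scan_step_def)

lemma tick_simps [simp]:
  "nreg (tick s) = nreg s" "rreg (tick s) = rreg s" "imem (tick s) = imem s"
  "rmem (tick s) = rmem s" "cur (tick s) = cur s" "icells (tick s) = icells s"
  "rcells (tick s) = rcells s" "queries (tick s) = queries s" "passes (tick s) = passes s"
  "time (tick s) = Suc (time s)"
  by (simp_all add: tick_def)

text \<open>
  Register conventions. Natural-number registers: 0 is the number of output cells, 1 the length of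
  the current list \<open>T\<close>, which occupies the cells from 1 on; cell 0 holds the item that the
  output adds to a prefix of \<open>T\<close>. Real registers: 2 is a lower bound on the value of the output,
  3 the guess \<open>v\<close> and 4 the estimate of the optimum, 5 the cost of \<open>T\<close>, 6 and 7 receive
  oracle values, and 8 is the position \<open>u\<close> of the current threshold.
\<close>

definition append_cur :: com where
  "append_cur = Seq (NSet 1 (NAdd (NReg 1) (NConst 1)))
    (Seq (IStore (NReg 1) Cur) (RSet 5 (RAdd (RReg 5) (RCost Cur))))"

text \<open>\<open>k\<close> counts the output cells. The output is not copied: it consists of cell
  0 and a prefix of the cells of \<open>T\<close>, and remains valid while \<open>T\<close> only
  grows.\<close>

definition record_cur :: "nexp \<Rightarrow> com" where
  "record_cur k = Cond (RLess (RReg 2) (RReg 7))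
     (Seq (NSet 0 k) (Seq (IStore (NConst 0) Cur) (RSet 2 (RReg 7)))) Skip"

definition query_list :: "nat \<Rightarrow> iref list \<Rightarrow> com" where
  "query_list r xs = Query r (NConst 1) (NAdd (NReg 1) (NConst 1)) xs"

text \<open>The estimate \<open>v + f B\<close> is refreshed after every item, so register 4 is
  final when the stream ends and stays 0 on an empty stream.\<close>

definition estimate_body :: com where
  "estimate_body =
    Seq (Query 7 (NConst 0) (NConst 0) [Cur])
    (Seq (record_cur (NConst 1))
    (Seq (query_list 6 [])
    (Seq (query_list 7 [Cur])
    (Seq (Cond (RLess (RMul (RDiv (RMul (RConst 2) (RReg 3)) (RReg 0)) (RCost Cur))
                 (RSub (RReg 7) (RReg 6)))
            (Cond (RLess (RReg 0) (RAdd (RReg 5) (RCost Cur)))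
               (Seq (RSet 3 (RReg 7)) (Seq (NSet 1 (NConst 0)) (RSet 5 (RConst 0))))
               append_cur)
            Skip)
    (Seq (query_list 6 [])
         (RSet 4 (RAdd (RReg 3) (RReg 6))))))))"

text \<open>The factor 4 turns the estimate \<open>L\<close> in register 4 into the upper bound
  \<open>\<Lambda> = 4 * L\<close> on the optimum.\<close>

definition threshold_exp :: rexp where
  "threshold_exp = RMul (RDiv (RMul (RConst 4) (RReg 4)) (RReg 0))
     (RSub (RDiv (RConst 1) (RReg 8)) (RConst 1))"

definition sieve_body :: com where
  "sieve_body =
    Seq (query_list 6 [])
    (Seq (query_list 7 [Cur])
      (Cond (RLess (RReg 0) (RAdd (RReg 5) (RCost Cur))) Skip
        (Seq (record_cur (NAdd (NReg 1) (NConst 1)))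
          (Cond (RLess (RMul threshold_exp (RCost Cur)) (RSub (RReg 7) (RReg 6)))
            append_cur Skip))))"

definition step_exp :: rexp where
  "step_exp = RDiv (RReg 1) (RConst 2000)"

text \<open>Testing \<open>u + \<delta> < 1\<close> instead of \<open>u < 1\<close> keeps every
  position used more than \<open>\<delta>\<close> below 1, which the comparison of consecutive
  thresholds relies on.\<close>

definition sieve_loop :: prog where
  "sieve_loop = PWhile (RLess (RAdd (RReg 8) step_exp) (RConst 1))
     (PSeq (Pass sieve_body) (Local (RSet 8 (RAdd (RReg 8) step_exp))))"

definition sieve_max :: prog where
  "sieve_max = PCond (RLess (RMul (RConst 2) (RReg 1)) (RConst 1))
    (PSeq (Pass estimate_body)
      (PCond (RLess (RConst 0) (RReg 4))
        (PSeq (Local (Seq (NSet 1 (NConst 0)) (Seq (RSet 5 (RConst 0)) (RSet 8 step_exp))))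
          sieve_loop)
        (Local Skip)))
    (Local Skip)"

lemma loop_free_bodies [simp]: "loop_free estimate_body" "loop_free sieve_body"
  by (simp_all add: estimate_body_def sieve_body_def append_cur_def record_cur_def query_list_def)

section \<open>Lists of items in memory\<close>

definition stores :: "('a \<Rightarrow> real) \<Rightarrow> 'a state \<Rightarrow> 'a list \<Rightarrow> bool" where
  "stores c s T \<longleftrightarrow> nreg s 1 = length T \<and> (\<forall>i<length T. imem s (Suc i) = Some (T ! i)) \<and>
     rreg s 5 = sum_list (map c T) \<and> nreg s 0 \<le> Suc (length T)"

lemma items_in_stores:
  assumes "stores c s T" "p \<le> length T"
  shows "items_in s (Suc 0) (Suc p) = set (take p T)"
proof -
  have "items_in s (Suc 0) (Suc p) = {e. \<exists>i<p. imem s (Suc i) = Some e}"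
    unfolding items_in_def by (auto simp: Suc_le_eq gr0_conv_Suc)
  also have "\<dots> = {e. \<exists>i<p. T ! i = e}" using assms by (auto simp: stores_def)
  also have "\<dots> = set (take p T)" unfolding nth_image[OF assms(2), symmetric] by auto
  finally show ?thesis .
qed

lemma items_in_0: "items_in s 0 (Suc p) = {e. imem s 0 = Some e} \<union> items_in s (Suc 0) (Suc p)"
  unfolding items_in_def by (auto simp: Suc_le_eq)

lemma eval_query_list:
  assumes "stores c s T" "cur s = Some e" "r \<noteq> 5" "xs = [] \<or> xs = [Cur]"
    and "t = eval_com f c (query_list r xs) s"
  shows "stores c t T" "output_set t = output_set s" "cur t = Some e" "nreg t 0 = nreg s 0"
    "rreg t = (rreg s)(r := f (if xs = [] then set T else insert e (set T)))"
    "icells t = icells s" "rcells t = rcells s" "passes t = passes s"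
    "queries t = queries s + 1" "time t = time s + 1"
proof -
  have "nreg s (Suc 0) = length T" using assms(1) by (simp add: stores_def)
  then have "query_set s (NConst 1) (NAdd (NReg 1) (NConst 1)) xs =
    (if xs = [] then set T else insert e (set T))"
    using assms(2,4) items_in_stores[OF assms(1), of "length T"] by (auto simp: query_set_def)
  then show "rreg t = (rreg s)(r := f (if xs = [] then set T else insert e (set T)))"
    using assms by (simp add: query_list_def)
qed (use assms in \<open>auto simp: query_list_def stores_def output_set_def items_in_def\<close>)

lemma eval_append_cur:
  assumes "stores c s T" "cur s = Some e" and "t = eval_com f c append_cur s"
  shows "stores c t (T @ [e])" "output_set t = output_set s" "cur t = Some e" "nreg t 0 = nreg s 0"
    "rreg t = (rreg s)(5 := rreg s 5 + c e)"
    "icells t = insert (Suc (length T)) (icells s)" "rcells t = rcells s" "passes t = passes s"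
    "queries t = queries s" "time t = time s + 3"
proof -
  have "nreg t 0 = nreg s 0" "nreg s 0 \<le> Suc (length T)"
    "imem t = (imem s)(Suc (length T) := Some e)"
    using assms by (auto simp: append_cur_def stores_def)
  \<comment> \<open>The item goes to address \<open>Suc (length T)\<close>, just beyond the output
    cells by the last clause of \<open>stores\<close>.\<close>
  then show "output_set t = output_set s"
    unfolding output_set_def items_in_def by (metis (no_types, lifting) fun_upd_other not_less)
qed (use assms in \<open>auto simp: append_cur_def stores_def nth_append less_Suc_eq\<close>)

lemma eval_record_cur:
  assumes "stores c s T" "cur s = Some e" "nval s k = Suc p" "p \<le> length T"
    and "t = eval_com f c (record_cur k) s"
  shows "stores c t T" "cur t = Some e"
    "nreg t 0 = (if rreg s 2 < rreg s 7 then Suc p else nreg s 0)"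
    "output_set t = (if rreg s 2 < rreg s 7 then insert e (set (take p T)) else output_set s)"
    "rreg t = (rreg s)(2 := max (rreg s 2) (rreg s 7))"
    "icells t \<subseteq> insert 0 (icells s)" "rcells t = rcells s" "passes t = passes s"
    "queries t = queries s" "time t \<le> time s + 3"
proof -
  show st: "stores c t T" using assms by (auto simp: record_cur_def stores_def)
  show "output_set t = (if rreg s 2 < rreg s 7 then insert e (set (take p T)) else output_set s)"
  proof (cases "rreg s 2 < rreg s 7")
    case True
    have "nreg t 0 = Suc p" "imem t 0 = Some e"
      using assms True by (auto simp: record_cur_def stores_def)
    then show ?thesis
      using True items_in_stores[OF st assms(4)] by (auto simp: output_set_def items_in_0)
  qed (use assms in \<open>simp add: record_cur_def\<close>)
qed (use assms in \<open>auto simp: record_cur_def\<close>)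

section \<open>Correctness and resource bounds\<close>

context knapsack
begin

section \<open>The block pass and its estimate of the optimum\<close>

definition cost :: "'a list \<Rightarrow> real" where "cost T = sum_list (map c T)"

lemma cost_simps [simp]: "cost [] = 0" "cost (T @ [e]) = cost T + c e"
  by (simp_all add: cost_def)

lemma cost_distinct: "distinct T \<Longrightarrow> cost T = sum c (set T)"
  by (simp add: cost_def sum.distinct_set_conv_list)

definition block_step :: "real \<times> 'a list \<Rightarrow> 'a \<Rightarrow> real \<times> 'a list" where
  "block_step = (\<lambda>(v, B) e.
     if 2 * v / K * c e < f (insert e (set B)) - f (set B)
     then if K < cost B + c e then (f (insert e (set B)), []) else (v, B @ [e])
     else (v, B))"

definition sieve_step :: "real \<Rightarrow> 'a list \<Rightarrow> 'a \<Rightarrow> 'a list" where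
  "sieve_step t T e =
     (if cost T + c e \<le> K \<and> t * c e < f (insert e (set T)) - f (set T) then T @ [e] else T)"

text \<open>Register 2 is only a lower bound: initially it is 0, while the value \<open>f {}\<close>
  of the empty output may be positive.\<close>

definition solved :: "'a state \<Rightarrow> bool" where
  "solved s \<longleftrightarrow> feasible (set es) c K (output_set s) \<and> rreg s 2 \<le> f (output_set s) \<and> 0 \<le> rreg s 2"

text \<open>\<open>B\<close> is the current block, \<open>D\<close> the set of all items of the discarded blocks.\<close>

definition block_inv :: "'a list \<Rightarrow> real \<Rightarrow> 'a list \<Rightarrow> bool" where
  "block_inv xs v B \<longleftrightarrow> distinct B \<and> set B \<subseteq> set xs \<and> cost B \<le> K \<and> 0 \<le> v \<and>
     2 * v / K * cost B \<le> f (set B) \<and>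
     (\<exists>S S'. feasible (set es) c K S \<and> feasible (set es) c K S' \<and> v \<le> f S + f S') \<and>
     (\<exists>D \<subseteq> set xs. f (D \<union> set B) \<le> 2 * v + f (set B) \<and>
        (\<forall>e\<in>set xs. f (insert e (D \<union> set B)) - f (D \<union> set B) \<le> 2 * v / K * c e))"

lemma feasible_empty: "feasible (set es) c K {}"
  using K_pos by (simp add: feasible_def)

lemma feasible_singleton: "e \<in> set es \<Longrightarrow> feasible (set es) c K {e}"
  using cost_le_K by (simp add: feasible_def)

lemma block_inv_init: "block_inv [] 0 []"
  unfolding block_inv_def using K_pos f_nonneg[of "{}"] feasible_empty
  by (auto intro!: exI[of _ "{}"])

text \<open>A rejected item stays rejected with respect to \<open>D \<union> B\<close>, by
  submodularity. An overflow at least doubles \<open>v\<close>, which keeps \<open>2 * v\<close>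
  above the total value of the discarded blocks.\<close>

lemma block_inv_step:
  assumes inv: "block_inv xs v B" and xs: "set (xs @ [e]) \<subseteq> set es" "distinct (xs @ [e])"
    and step: "block_step (v, B) e = (v', B')"
  shows "block_inv (xs @ [e]) v' B'"
proof -
  obtain S S' D where S: "feasible (set es) c K S" "feasible (set es) c K S'" "v \<le> f S + f S'"
    and D: "D \<subseteq> set xs" "f (D \<union> set B) \<le> 2 * v + f (set B)"
      "\<And>x. x \<in> set xs \<Longrightarrow> f (insert x (D \<union> set B)) - f (D \<union> set B) \<le> 2 * v / K * c x"
    and B: "distinct B" "set B \<subseteq> set xs" "cost B \<le> K" "0 \<le> v" "2 * v / K * cost B \<le> f (set B)"
    using inv unfolding block_inv_def by blast
  have K: "0 < K" by (rule K_pos)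
  have e: "e \<in> set es" "e \<in> U" "e \<notin> set B" "0 \<le> c e" using xs B es_U cost_ge_1[of e] by auto
  have U: "D \<union> set B \<subseteq> U" "set B \<subseteq> U" using xs B D es_U by auto
  let ?A = "D \<union> set B"
  have sub: "f (insert e ?A) - f ?A \<le> f (insert e (set B)) - f (set B)"
    using U e by (intro f_submodular) auto
  consider (reject) "f (insert e (set B)) - f (set B) \<le> 2 * v / K * c e" "v' = v" "B' = B"
    | (drop) "2 * v / K * c e < f (insert e (set B)) - f (set B)" "K < cost B + c e"
      "v' = f (insert e (set B))" "B' = []"
    | (add) "2 * v / K * c e < f (insert e (set B)) - f (set B)" "cost B + c e \<le> K"
      "v' = v" "B' = B @ [e]"
    using step by (auto simp: block_step_def split: if_splits)
  then show ?thesis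
  proof cases
    case reject
    have "\<exists>D \<subseteq> set (xs @ [e]). f (D \<union> set B) \<le> 2 * v + f (set B) \<and>
        (\<forall>e\<in>set (xs @ [e]). f (insert e (D \<union> set B)) - f (D \<union> set B) \<le> 2 * v / K * c e)"
      by (rule exI[of _ D]) (use D sub reject in auto)
    moreover have "set B \<subseteq> set (xs @ [e])" using B by auto
    ultimately show ?thesis unfolding block_inv_def reject using S B by blast
  next
    case drop
    \<comment> \<open>The block with \<open>e\<close> has density at least \<open>2 * v / K\<close>
      and cost above \<open>K\<close>, hence value at least \<open>2 * v\<close>.\<close>
    have "2 * v / K * K \<le> 2 * v / K * (cost B + c e)"
      using drop(2) B K by (intro mult_left_mono) auto
    also have "\<dots> \<le> v'" using drop(1,3) B(5) by (simp add: distrib_left)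
    finally have v': "2 * v \<le> v'" using K by simp
    \<comment> \<open>The overflowing set is infeasible but splits into the two feasible sets
      \<open>B\<close> and \<open>{e}\<close>, which is why the invariant bounds \<open>v\<close> by
      two feasible values.\<close>
    have "v' \<le> f (set B) + f {e}" unfolding drop using U e by (intro f_insert_le) auto
    moreover have "feasible (set es) c K (set B)"
      using B xs cost_distinct[of B] by (auto simp: feasible_def)
    ultimately have "\<exists>S S'. feasible (set es) c K S \<and> feasible (set es) c K S' \<and> v' \<le> f S + f S'"
      using feasible_singleton[OF e(1)] by blast
    moreover have "\<exists>D' \<subseteq> set (xs @ [e]). f (D' \<union> set []) \<le> 2 * v' + f (set []) \<and>
      (\<forall>x\<in>set (xs @ [e]). f (insert x (D' \<union> set [])) - f (D' \<union> set []) \<le> 2 * v' / K * c x)"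
    \<comment> \<open>The block and \<open>e\<close> join \<open>D\<close>. The new union is worth
      at most \<open>2 * v + f B + (v' - f B) = 2 * v + v'\<close>, which is at most
      \<open>2 * v'\<close>.\<close>
    proof (intro exI[of _ "insert e ?A"] conjI ballI)
      show "f (insert e ?A \<union> set []) \<le> 2 * v' + f (set [])"
        using sub D(2) drop(3) v' f_nonneg[of "{}"] by simp
      fix x assume x: "x \<in> set (xs @ [e])"
      have cx: "0 \<le> c x" using x xs cost_ge_1[of x] by force
      have v'0: "0 \<le> v'" using v' B by simp
      show "f (insert x (insert e ?A \<union> set [])) - f (insert e ?A \<union> set []) \<le> 2 * v' / K * c x"
      proof (cases "x = e")
        case False
        then have x': "x \<in> set xs" using x by auto
        have "f (insert x (insert e ?A)) - f (insert e ?A) \<le> f (insert x ?A) - f ?A"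
          using U e x xs es_U by (intro f_submodular) auto
        also have "\<dots> \<le> 2 * v / K * c x" by (rule D(3)[OF x'])
        also have "\<dots> \<le> 2 * v' / K * c x"
          using v' B K cx by (intro mult_right_mono divide_right_mono) auto
        finally show ?thesis by simp
      qed (use v'0 cx K in simp)
    qed (use D B in auto)
    ultimately show ?thesis unfolding block_inv_def drop(4)
      using v' B K f_nonneg[of "{}"] by simp
  next
    case add
    have "\<exists>D \<subseteq> set (xs @ [e]). f (D \<union> set (B @ [e])) \<le> 2 * v + f (set (B @ [e])) \<and>
      (\<forall>x\<in>set (xs @ [e]).
        f (insert x (D \<union> set (B @ [e]))) - f (D \<union> set (B @ [e])) \<le> 2 * v / K * c x)"
    proof (intro exI[of _ D] conjI ballI)
      show "f (D \<union> set (B @ [e])) \<le> 2 * v + f (set (B @ [e]))" using sub D(2) by simp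
      fix x assume x: "x \<in> set (xs @ [e])"
      have cx: "0 \<le> c x" using x xs cost_ge_1[of x] by force
      show "f (insert x (D \<union> set (B @ [e]))) - f (D \<union> set (B @ [e])) \<le> 2 * v / K * c x"
      proof (cases "x = e")
        case False
        then have x': "x \<in> set xs" using x by auto
        have "f (insert x (insert e ?A)) - f (insert e ?A) \<le> f (insert x ?A) - f ?A"
          using U e x xs es_U by (intro f_submodular) auto
        also have "\<dots> \<le> 2 * v / K * c x" by (rule D(3)[OF x'])
        finally show ?thesis by simp
      qed (use B cx K in simp)
    qed (use D in auto)
    moreover have "2 * v / K * cost (B @ [e]) \<le> f (set (B @ [e]))"
      using add(1) B(5) by (simp add: distrib_left)
    moreover have "set (B @ [e]) \<subseteq> set (xs @ [e])" "distinct (B @ [e])" using B e by auto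
    ultimately show ?thesis unfolding block_inv_def add(3,4) using S B add(2) by auto
  qed
qed

text \<open>Adding \<open>Opt\<close> to \<open>D \<union> B\<close> gains at most density
  \<open>2 * v / K\<close> on cost at most \<open>K\<close>, so
  \<open>f Opt \<le> 2 * v + f B + 2 * v\<close>. Conversely \<open>v + f B\<close> is bounded by
  three feasible values.\<close>

lemma block_inv_estimate:
  assumes inv: "block_inv es v B" and opt: "feasible (set es) c K Opt"
    and max: "\<And>S. feasible (set es) c K S \<Longrightarrow> f S \<le> f Opt"
  shows "f Opt \<le> 4 * (v + f (set B))" "v + f (set B) \<le> 3 * f Opt"
proof -
  obtain S S' D where S: "feasible (set es) c K S" "feasible (set es) c K S'" "v \<le> f S + f S'"
    and D: "D \<subseteq> set es" "f (D \<union> set B) \<le> 2 * v + f (set B)"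
      "\<And>x. x \<in> set es \<Longrightarrow> f (insert x (D \<union> set B)) - f (D \<union> set B) \<le> 2 * v / K * c x"
    and B: "distinct B" "set B \<subseteq> set es" "cost B \<le> K" "0 \<le> v"
    using inv unfolding block_inv_def by blast
  have K: "0 < K" by (rule K_pos)
  have "feasible (set es) c K (set B)" using B cost_distinct[of B] by (simp add: feasible_def)
  then show "v + f (set B) \<le> 3 * f Opt" using S max[of S] max[of S'] max[of "set B"] by linarith
  have O: "Opt \<subseteq> set es" "sum c Opt \<le> K" using opt by (auto simp: feasible_def)
  have "f Opt \<le> f (D \<union> set B \<union> Opt)" using O D B es_U by (intro f_mono) auto
  also have "\<dots> \<le> f (D \<union> set B) + 2 * v / K * sum c Opt"
    using O D B es_U by (intro f_union_le) auto
  also have "2 * v / K * sum c Opt \<le> 2 * v / K * K"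
    using O B K by (intro mult_left_mono) auto
  finally have "f Opt \<le> 4 * v + f (set B)" using D K by simp
  moreover have "0 \<le> f (set B)" using B es_U by (intro f_nonneg) auto
  ultimately show "f Opt \<le> 4 * (v + f (set B))" by simp
qed

section \<open>One stream item: the program against the list functions\<close>

lemma estimate_step:
  assumes st: "stores c s B" and K: "rreg s 0 = K" and e: "e \<in> set es" and sol: "solved s"
    and n0: "nreg s 0 \<le> 1"
    and step: "block_step (rreg s 3, B) e = (v', B')" and t: "t = scan_step f c estimate_body s e"
  shows "stores c t B'" "rreg t 0 = K" "rreg t 1 = rreg s 1" "rreg t 3 = v'"
    "rreg t 4 = v' + f (set B')" "solved t" "rreg s 2 \<le> rreg t 2" "f {e} \<le> rreg t 2"
    "nreg t 0 \<le> 1"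
    "icells t \<subseteq> icells s \<union> {..length B'}" "rcells t = rcells s" "passes t = passes s"
    "queries t = queries s + 4" "time t \<le> time s + 20"
proof -
  define s0 where "s0 = tick (s\<lparr>cur := Some e\<rparr>)"
  define s1 where "s1 = eval_com f c (Query 7 (NConst 0) (NConst 0) [Cur]) s0"
  define s2 where "s2 = eval_com f c (record_cur (NConst 1)) s1"
  define s3 where "s3 = eval_com f c (query_list 6 []) s2"
  define s4 where "s4 = eval_com f c (query_list 7 [Cur]) s3"
  define p where "p = Cond (RLess (RMul (RDiv (RMul (RConst 2) (RReg 3)) (RReg 0)) (RCost Cur))
                 (RSub (RReg 7) (RReg 6)))
            (Cond (RLess (RReg 0) (RAdd (RReg 5) (RCost Cur)))
               (Seq (RSet 3 (RReg 7)) (Seq (NSet 1 (NConst 0)) (RSet 5 (RConst 0))))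
               append_cur)
            Skip"
  define s5 where "s5 = eval_com f c p s4"
  define s6 where "s6 = eval_com f c (query_list 6 []) s5"
  have t6: "t = eval_com f c (RSet 4 (RAdd (RReg 3) (RReg 6))) s6"
    unfolding t scan_step_def estimate_body_def s6_def s5_def s4_def s3_def s2_def s1_def s0_def p_def
    by simp
  have "query_set s0 (NConst 0) (NConst 0) [Cur] = {e}"
    by (auto simp: s0_def query_set_def items_in_def)
  then have 1: "stores c s1 B" "output_set s1 = output_set s" "cur s1 = Some e" "nreg s1 0 = nreg s 0"
    "rreg s1 = (rreg s)(7 := f {e})" "icells s1 = icells s" "rcells s1 = rcells s"
    "passes s1 = passes s" "queries s1 = queries s + 1" "time s1 = time s + 2"
    using st by (simp_all add: s1_def s0_def stores_def output_set_def items_in_def)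
  note 2 = eval_record_cur[OF 1(1) 1(3) _ _ s2_def, of 0, simplified]
  note 3 = eval_query_list[OF 2(1) 2(2) _ _ s3_def, simplified]
  note 4 = eval_query_list[OF 3(1) 3(3) _ _ s4_def, simplified]
  have r4: "rreg s4 0 = K" "rreg s4 1 = rreg s 1" "rreg s4 2 = max (rreg s 2) (f {e})"
    "rreg s4 3 = rreg s 3" "rreg s4 6 = f (set B)" "rreg s4 7 = f (insert e (set B))"
    using 4 3 2 1 K by auto
  have r45: "rreg s4 5 = cost B" using 4(1) by (simp add: stores_def cost_def)
  have n4: "nreg s4 0 \<le> 1" using 4(4) 3(4) 2(3) 1(4) n0 by simp
  have 5: "stores c s5 B'" "output_set s5 = output_set s4" "cur s5 = Some e" "nreg s5 0 \<le> 1"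
    "rreg s5 0 = K" "rreg s5 1 = rreg s4 1" "rreg s5 2 = rreg s4 2" "rreg s5 3 = v'"
    "icells s5 \<subseteq> icells s4 \<union> {..length B'}" "rcells s5 = rcells s4"
    "passes s5 = passes s4" "queries s5 = queries s4" "time s5 \<le> time s4 + 3"
  proof -
    define G where "G \<longleftrightarrow> 2 * rreg s 3 / K * c e < f (insert e (set B)) - f (set B)"
    define H where "H \<longleftrightarrow> K < cost B + c e"
    have s5: "s5 = (if G then if H then eval_com f c (Seq (RSet 3 (RReg 7))
        (Seq (NSet 1 (NConst 0)) (RSet 5 (RConst 0)))) s4 else eval_com f c append_cur s4 else s4)"
      using r4 r45 4(3) by (simp add: s5_def p_def G_def H_def)
    have st4: "stores c s4 B" "cur s4 = Some e" using 4 by auto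
    have vB: "(v', B') = (if G then if H then (f (insert e (set B)), []) else (rreg s 3, B @ [e])
      else (rreg s 3, B))"
      unfolding step[symmetric] by (simp add: block_step_def G_def H_def)
    consider "\<not> G" | "G" "H" | "G" "\<not> H" by blast
    then have "stores c s5 B' \<and> output_set s5 = output_set s4 \<and> cur s5 = Some e \<and> nreg s5 0 \<le> 1 \<and>
      rreg s5 0 = K \<and> rreg s5 1 = rreg s4 1 \<and> rreg s5 2 = rreg s4 2 \<and> rreg s5 3 = v' \<and>
      icells s5 \<subseteq> icells s4 \<union> {..length B'} \<and> rcells s5 = rcells s4 \<and>
      passes s5 = passes s4 \<and> queries s5 = queries s4 \<and> time s5 \<le> time s4 + 3"
    proof cases
      case 1
      then show ?thesis using s5 vB st4 r4 n4 by auto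
    next
      case 2
      \<comment> \<open>Dropping the block sets the length to 0, and \<open>stores\<close> then asks
        that the output lie in cell 0 alone; hence the bound \<open>nreg s 0 \<le> 1\<close> during
        this pass.\<close>
      then show ?thesis using s5 vB st4 r4 n4
        by (auto simp: stores_def output_set_def items_in_def)
    next
      case 3
      then have "s5 = eval_com f c append_cur s4" using s5 by simp
      from eval_append_cur[OF st4 this] show ?thesis using vB 3 r4 n4 by auto
    qed
    then show "stores c s5 B'" "output_set s5 = output_set s4" "cur s5 = Some e" "nreg s5 0 \<le> 1"
      "rreg s5 0 = K" "rreg s5 1 = rreg s4 1" "rreg s5 2 = rreg s4 2" "rreg s5 3 = v'"
      "icells s5 \<subseteq> icells s4 \<union> {..length B'}" "rcells s5 = rcells s4"
      "passes s5 = passes s4" "queries s5 = queries s4" "time s5 \<le> time s4 + 3" by blast+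
  qed
  note 6 = eval_query_list[OF 5(1) 5(3) _ _ s6_def, simplified]
  have out: "output_set t = (if rreg s 2 < f {e} then {e} else output_set s)"
    using t6 6(2) 5(2) 4(2) 3(2) 2(4) 1 by (simp add: output_set_def items_in_def)
  have r2: "rreg t 2 = max (rreg s 2) (f {e})" using t6 6 5 r4 by simp
  show "solved t" using sol feasible_singleton[OF e] unfolding solved_def out r2 by auto
  show "rreg s 2 \<le> rreg t 2" "f {e} \<le> rreg t 2" by (simp_all add: r2)
  show "stores c t B'" using t6 6(1) by (simp add: stores_def)
  show "rreg t 0 = K" "rreg t 1 = rreg s 1" "rreg t 3 = v'" "rreg t 4 = v' + f (set B')" "nreg t 0 \<le> 1"
    using t6 6 5 r4 by simp_all
  show "icells t \<subseteq> icells s \<union> {..length B'}" using t6 6 5 4 3 2 1 by auto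
  show "rcells t = rcells s" "passes t = passes s" "queries t = queries s + 4" "time t \<le> time s + 20"
    using t6 6 5 4 3 2 1 by simp_all
qed

text \<open>Recording precedes the density test, so a feasible \<open>T + e\<close> is a candidate
  even if \<open>e\<close> is then rejected.\<close>

lemma sieve_body_step:
  assumes st: "stores c s T" and K: "rreg s 0 = K" and e: "e \<in> set es" and sol: "solved s"
    and T: "distinct T" "set T \<subseteq> set es" and th: "th = rval c s threshold_exp"
    and t: "t = scan_step f c sieve_body s e"
  shows "stores c t (sieve_step th T e)" "rreg t 0 = K" "rreg t 1 = rreg s 1" "rreg t 4 = rreg s 4"
    "rreg t 8 = rreg s 8" "solved t" "rreg s 2 \<le> rreg t 2"
    "cost T + c e \<le> K \<Longrightarrow> f (insert e (set T)) \<le> rreg t 2"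
    "icells t \<subseteq> icells s \<union> {..length (sieve_step th T e)}" "rcells t = rcells s"
    "passes t = passes s" "queries t = queries s + 2" "time t \<le> time s + 20"
proof -
  define s0 where "s0 = tick (s\<lparr>cur := Some e\<rparr>)"
  define s1 where "s1 = eval_com f c (query_list 6 []) s0"
  define s2 where "s2 = eval_com f c (query_list 7 [Cur]) s1"
  define p where "p = Cond (RLess (RMul threshold_exp (RCost Cur)) (RSub (RReg 7) (RReg 6)))
            append_cur Skip"
  define s3 where "s3 = eval_com f c (record_cur (NAdd (NReg 1) (NConst 1))) s2"
  have 0: "stores c s0 T" "cur s0 = Some e" "output_set s0 = output_set s"
    using st by (simp_all add: s0_def stores_def output_set_def items_in_def)
  note 1 = eval_query_list[OF 0(1,2) _ _ s1_def, simplified]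
  note 2 = eval_query_list[OF 1(1) 1(3) _ _ s2_def, simplified]
  have t2: "t = (if K < cost T + c e then s2 else eval_com f c p s3)"
    using 2(1,3,5) 1(5) K
    unfolding t scan_step_def sieve_body_def s3_def s2_def s1_def s0_def p_def
    by (simp add: stores_def cost_def)
  have r2: "rreg s2 = (rreg s)(6 := f (set T), 7 := f (insert e (set T)))"
    using 2 1 by (simp add: s0_def)
  have "stores c t (sieve_step th T e) \<and> rreg t 0 = K \<and> rreg t 1 = rreg s 1 \<and>
      rreg t 4 = rreg s 4 \<and> rreg t 8 = rreg s 8 \<and> solved t \<and> rreg s 2 \<le> rreg t 2 \<and>
      (cost T + c e \<le> K \<longrightarrow> f (insert e (set T)) \<le> rreg t 2) \<and>
      icells t \<subseteq> icells s \<union> {..length (sieve_step th T e)} \<and> rcells t = rcells s \<and>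
      passes t = passes s \<and> queries t = queries s + 2 \<and> time t \<le> time s + 20"
  proof (cases "K < cost T + c e")
    case True
    then have "t = s2" "sieve_step th T e = T" using t2 by (auto simp: sieve_step_def)
    then show ?thesis
      using True 0 1 2 r2 K sol by (simp add: solved_def s0_def)
  next
    case False
    have "nval s2 (NAdd (NReg 1) (NConst 1)) = Suc (length T)" using 2(1) by (simp add: stores_def)
    note 3 = eval_record_cur[OF 2(1) 2(3) this order_refl s3_def]
    have thv: "rval c s3 threshold_exp = th" "rreg s3 6 = f (set T)" "rreg s3 7 = f (insert e (set T))"
      using 3(5) r2 th by (simp_all add: threshold_exp_def)
    have t3: "t = (if th * c e < f (insert e (set T)) - f (set T) then eval_com f c append_cur s3 else s3)"
      using t2 False thv 3(2) by (simp add: p_def)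
    have feas: "feasible (set es) c K (insert e (set T))"
    proof -
      have "sum c (insert e (set T)) \<le> sum c (set T) + c e"
        using cost_ge_1[OF e] by (simp add: sum.insert_if)
      then show ?thesis using False T e cost_distinct[OF T(1)] by (simp add: feasible_def)
    qed
    have sol3: "solved s3" using sol feas 3(4,5) r2 2(2) 1(2) 0(3) by (auto simp: solved_def)
    show ?thesis
    proof (cases "th * c e < f (insert e (set T)) - f (set T)")
      case True
      then have t4: "t = eval_com f c append_cur s3" and T': "sieve_step th T e = T @ [e]"
        using t3 False by (auto simp: sieve_step_def)
      note 4 = eval_append_cur[OF 3(1,2) t4]
      have "solved t" using sol3 4 by (simp add: solved_def)
      then show ?thesis using T' 4 3 2 1 r2 K by (auto simp: s0_def)
    next
      case F: False
      then have t4: "t = s3" and T': "sieve_step th T e = T"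
        using t3 by (auto simp: sieve_step_def)
      then show ?thesis using sol3 3 2 1 r2 K by (auto simp: s0_def)
    qed
  qed
  then show "stores c t (sieve_step th T e)" "rreg t 0 = K" "rreg t 1 = rreg s 1" "rreg t 4 = rreg s 4"
    "rreg t 8 = rreg s 8" "solved t" "rreg s 2 \<le> rreg t 2"
    "cost T + c e \<le> K \<Longrightarrow> f (insert e (set T)) \<le> rreg t 2"
    "icells t \<subseteq> icells s \<union> {..length (sieve_step th T e)}" "rcells t = rcells s"
    "passes t = passes s" "queries t = queries s + 2" "time t \<le> time s + 20"
    by blast+
qed

section \<open>Space bound and the first pass\<close>

definition cell_bound :: nat where
  "cell_bound = nat \<lfloor>min (real (length es)) K\<rfloor>"

text \<open>Every item costs at least 1, so the budget also bounds the number of items. Cells 1 to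
  \<open>cell_bound\<close> hold the list, and cell 0 the extra output item.\<close>

lemma length_le_cell_bound:
  assumes "distinct T" "set T \<subseteq> set es" "cost T \<le> K"
  shows "length T \<le> cell_bound"
proof -
  have "length T \<le> length es"
    using assms distinct_card[of T] card_mono[OF _ assms(2)] card_length[of es] by simp
  moreover have "real (length T) \<le> K" using length_le_cost[OF assms(2)] assms(3) by (simp add: cost_def)
  ultimately have "real (length T) \<le> min (real (length es)) K" by simp
  then have "int (length T) \<le> \<lfloor>min (real (length es)) K\<rfloor>" by (simp add: le_floor_iff)
  then show ?thesis unfolding cell_bound_def by linarith
qed

text \<open>The case \<open>xs = []\<close> is separate because register 4 is still 0 there, and
  because on an empty stream \<open>min n K\<close> is 0, so that no cell may be written.\<close>

definition estimate_inv :: "real \<Rightarrow> 'a list \<Rightarrow> 'a state \<Rightarrow> bool" where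
  "estimate_inv \<epsilon> xs s \<longleftrightarrow>
     (\<exists>B. stores c s B \<and> block_inv xs (rreg s 3) B \<and>
       rreg s 4 = (if xs = [] then 0 else rreg s 3 + f (set B))) \<and>
     rreg s 0 = K \<and> rreg s 1 = \<epsilon> \<and> solved s \<and> (\<forall>e\<in>set xs. f {e} \<le> rreg s 2) \<and> nreg s 0 \<le> 1 \<and>
     icells s \<subseteq> (if xs = [] then {} else {..cell_bound}) \<and> rcells s = {} \<and> passes s = 1 \<and>
     queries s = 4 * length xs \<and> time s \<le> 20 * length xs"

lemma estimate_inv_step:
  assumes inv: "estimate_inv \<epsilon> xs s" and xs: "set (xs @ [e]) \<subseteq> set es" "distinct (xs @ [e])"
  shows "estimate_inv \<epsilon> (xs @ [e]) (scan_step f c estimate_body s e)"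
proof -
  obtain B where B: "stores c s B" "block_inv xs (rreg s 3) B"
    using inv unfolding estimate_inv_def by blast
  have s: "rreg s 0 = K" "rreg s 1 = \<epsilon>" "solved s" "\<forall>e\<in>set xs. f {e} \<le> rreg s 2" "nreg s 0 \<le> 1"
    "icells s \<subseteq> (if xs = [] then {} else {..cell_bound})" "rcells s = {}" "passes s = 1"
    "queries s = 4 * length xs" "time s \<le> 20 * length xs"
    using inv unfolding estimate_inv_def by auto
  obtain v' B' where step: "block_step (rreg s 3, B) e = (v', B')" by (cases "block_step (rreg s 3, B) e")
  define t where "t = scan_step f c estimate_body s e"
  have e: "e \<in> set es" using xs by simp
  note t = estimate_step[OF B(1) s(1) e s(3,5) step t_def]
  have inv': "block_inv (xs @ [e]) v' B'" by (rule block_inv_step[OF B(2) xs step])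
  then have "length B' \<le> cell_bound"
    using xs by (intro length_le_cell_bound) (auto simp: block_inv_def)
  then have "icells t \<subseteq> {..cell_bound}" using t(10) s(6) by (auto split: if_splits)
  moreover have "\<forall>e\<in>set (xs @ [e]). f {e} \<le> rreg t 2" using s(4) t(7,8) by auto
  ultimately show ?thesis unfolding t_def[symmetric] estimate_inv_def
    using t s inv' by auto
qed

lemma estimate_pass:
  assumes s: "s = init_state K \<epsilon>"
  shows "\<exists>t. run f c es (Pass estimate_body) s t \<and> estimate_inv \<epsilon> es t"
proof -
  define s0 where "s0 = s\<lparr>passes := passes s + 1\<rparr>"
  have init: "estimate_inv \<epsilon> [] s0"
    using block_inv_init f_nonneg[of "{}"] feasible_empty
    by (auto simp: estimate_inv_def s0_def s init_state_def stores_def solved_def output_set_def items_in_def)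
  have "estimate_inv \<epsilon> xs (foldl (scan_step f c estimate_body) s0 xs)"
    if "set xs \<subseteq> set es" "distinct xs" for xs
    using that
  proof (induction xs rule: rev_induct)
    case (snoc e xs)
    then show ?case using estimate_inv_step[of \<epsilon> xs _ e] by simp
  qed (use init in simp)
  from this[OF order_refl distinct_es] have "estimate_inv \<epsilon> es (foldl (scan_step f c estimate_body) s0 es)" .
  moreover have "estimate_inv \<epsilon> es (r\<lparr>cur := None\<rparr>) = estimate_inv \<epsilon> es r" for r
    by (simp add: estimate_inv_def stores_def solved_def output_set_def items_in_def)
  moreover have "run f c es (Pass estimate_body) s ((foldl (scan_step f c estimate_body) s0 es)\<lparr>cur := None\<rparr>)"
    unfolding s0_def by (intro run.Pass scan_foldl) simp
  ultimately show ?thesis by blast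
qed

section \<open>The sieve passes\<close>

definition sieve_inv :: "real \<Rightarrow> 'a list \<Rightarrow> 'a list \<Rightarrow> 'a list \<Rightarrow> bool" where
  "sieve_inv th T\<^sub>0 xs T \<longleftrightarrow> distinct T \<and> set T \<subseteq> set es \<and> cost T \<le> K \<and> set T\<^sub>0 \<subseteq> set T \<and>
     cost T\<^sub>0 \<le> cost T \<and> th * (cost T - cost T\<^sub>0) \<le> f (set T) - f (set T\<^sub>0) \<and>
     (\<forall>e\<in>set xs. cost T + c e \<le> K \<longrightarrow> f (insert e (set T)) - f (set T) \<le> th * c e)"

text \<open>As \<open>T\<close> grows, rejected items stay below the threshold by submodularity, and
  items that do not fit never fit again.\<close>

lemma sieve_inv_step:
  assumes inv: "sieve_inv th T\<^sub>0 xs T" and xs: "set (xs @ [e]) \<subseteq> set es" and th: "0 \<le> th"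
  shows "sieve_inv th T\<^sub>0 (xs @ [e]) (sieve_step th T e)"
proof (cases "cost T + c e \<le> K \<and> th * c e < f (insert e (set T)) - f (set T)")
  case True
  then have T': "sieve_step th T e = T @ [e]" by (simp add: sieve_step_def)
  have e: "e \<in> set es" "1 \<le> c e" using xs cost_ge_1 by auto
  have "0 \<le> th * c e" using th e by simp
  \<comment> \<open>An item of \<open>T\<close> met again in a later pass has gain 0, which does not
    exceed a nonnegative threshold times its cost.\<close>
  then have new: "e \<notin> set T" using True by (auto simp: insert_absorb)
  have U: "set T \<subseteq> U" "e \<in> U" using inv e es_U by (auto simp: sieve_inv_def)
  have "f (insert x (set (T @ [e]))) - f (set (T @ [e])) \<le> th * c x"
    if x: "x \<in> set (xs @ [e])" "cost (T @ [e]) + c x \<le> K" for x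
  proof (cases "x = e")
    case False
    have "f (insert x (insert e (set T))) - f (insert e (set T)) \<le> f (insert x (set T)) - f (set T)"
      using U x xs es_U by (intro f_submodular) auto
    also have "\<dots> \<le> th * c x" using inv x e False by (auto simp: sieve_inv_def)
    finally show ?thesis by simp
  qed (use \<open>0 \<le> th * c e\<close> in \<open>simp add: insert_absorb\<close>)
  then show ?thesis using inv True e new unfolding T' sieve_inv_def by (auto simp: algebra_simps)
next
  case False
  then have T': "sieve_step th T e = T" by (auto simp: sieve_step_def)
  then show ?thesis using inv False unfolding T' sieve_inv_def by auto
qed

lemma sieve_inv_foldl:
  assumes "distinct T\<^sub>0" "set T\<^sub>0 \<subseteq> set es" "cost T\<^sub>0 \<le> K" "0 \<le> th" "set xs \<subseteq> set es"
  shows "sieve_inv th T\<^sub>0 xs (foldl (sieve_step th) T\<^sub>0 xs)"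
  using assms(5)
proof (induction xs rule: rev_induct)
  case (snoc e xs)
  then show ?case using sieve_inv_step[of th T\<^sub>0 xs _ e] assms(4) by simp
qed (use assms in \<open>simp add: sieve_inv_def\<close>)

text \<open>For the candidates: if \<open>e\<close> fits with the final list, it fitted with the
  list \<open>A\<close> held when \<open>e\<close> was read, so \<open>A + e\<close> was recorded,
  and by monotonicity it is worth at least \<open>T\<^sub>0 + e\<close>.\<close>

lemma sieve_pass:
  assumes st: "stores c s T\<^sub>0" and K: "rreg s 0 = K" and sol: "solved s"
    and T0: "distinct T\<^sub>0" "set T\<^sub>0 \<subseteq> set es" "cost T\<^sub>0 \<le> K" "f (set T\<^sub>0) \<le> rreg s 2"
    and th: "th = rval c s threshold_exp" "0 \<le> th"
    and cells: "icells s \<subseteq> {..cell_bound}" "rcells s = {}"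
    and T: "T = foldl (sieve_step th) T\<^sub>0 es"
  shows "\<exists>t. run f c es (Pass sieve_body) s t \<and> stores c t T \<and> rreg t 0 = K \<and> rreg t 1 = rreg s 1 \<and>
    rreg t 4 = rreg s 4 \<and> rreg t 8 = rreg s 8 \<and> solved t \<and> rreg s 2 \<le> rreg t 2 \<and>
    f (set T) \<le> rreg t 2 \<and>
    (\<forall>e\<in>set es. cost T + c e \<le> K \<longrightarrow> f (insert e (set T\<^sub>0)) \<le> rreg t 2) \<and>
    icells t \<subseteq> {..cell_bound} \<and> rcells t = {} \<and> passes t = passes s + 1 \<and>
    queries t = queries s + 2 * length es \<and> time t \<le> time s + 20 * length es"
proof -
  define s0 where "s0 = s\<lparr>passes := passes s + 1\<rparr>"
  define P where "P xs T t \<longleftrightarrow> stores c t T \<and> rreg t 0 = K \<and> rreg t 1 = rreg s 1 \<and>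
    rreg t 4 = rreg s 4 \<and> rreg t 8 = rreg s 8 \<and> solved t \<and> rreg s 2 \<le> rreg t 2 \<and>
    f (set T) \<le> rreg t 2 \<and>
    (\<forall>e\<in>set xs. cost T + c e \<le> K \<longrightarrow> f (insert e (set T\<^sub>0)) \<le> rreg t 2) \<and>
    icells t \<subseteq> {..cell_bound} \<and> rcells t = {} \<and> passes t = passes s + 1 \<and>
    queries t = queries s + 2 * length xs \<and> time t \<le> time s + 20 * length xs" for xs T t
  have init: "P [] T\<^sub>0 s0"
    using st K sol T0 cells
    by (simp add: P_def s0_def stores_def solved_def output_set_def items_in_def)
  have "P xs (foldl (sieve_step th) T\<^sub>0 xs) (foldl (scan_step f c sieve_body) s0 xs)"
    if "set xs \<subseteq> set es" for xs
    using that
  proof (induction xs rule: rev_induct)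
    case (snoc e xs)
    define A where "A = foldl (sieve_step th) T\<^sub>0 xs"
    define r where "r = foldl (scan_step f c sieve_body) s0 xs"
    define t where "t = scan_step f c sieve_body r e"
    have e: "e \<in> set es" and xs: "set xs \<subseteq> set es" using snoc.prems by auto
    have r: "P xs A r" using snoc.IH[OF xs] by (simp add: A_def r_def)
    have A: "sieve_inv th T\<^sub>0 xs A" using T0 th xs by (simp add: A_def sieve_inv_foldl)
    have A': "sieve_inv th T\<^sub>0 (xs @ [e]) (sieve_step th A e)"
      using sieve_inv_step[OF A _ th(2)] snoc.prems by simp
    have thr: "th = rval c r threshold_exp"
      using r K unfolding th(1) by (simp add: P_def threshold_exp_def)
    have st_r: "stores c r A" "rreg r 0 = K" "solved r" using r by (auto simp: P_def)
    have dA: "distinct A" "set A \<subseteq> set es" "set T\<^sub>0 \<subseteq> set A" using A by (auto simp: sieve_inv_def)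
    note t = sieve_body_step[OF st_r(1,2) e st_r(3) dA(1,2) thr t_def]
    have "length (sieve_step th A e) \<le> cell_bound"
      using A' by (intro length_le_cell_bound) (auto simp: sieve_inv_def)
    then have "icells t \<subseteq> {..cell_bound}" using t(9) r by (fastforce simp: P_def)
    moreover have "f (set (sieve_step th A e)) \<le> rreg t 2"
      using t(7,8) r by (auto simp: sieve_step_def P_def)
    moreover have "f (insert x (set T\<^sub>0)) \<le> rreg t 2"
      if x: "x \<in> set (xs @ [e])" "cost (sieve_step th A e) + c x \<le> K" for x
    proof -
      have le: "cost A + c x \<le> K"
        using x(2) cost_ge_1[OF e] by (auto simp: sieve_step_def split: if_splits)
      show ?thesis
      proof (cases "x \<in> set xs")
        case True
        then show ?thesis using le r t(7) by (auto simp: P_def)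
      next
        case False
        then have "x = e" using x by simp
        have "f (insert e (set T\<^sub>0)) \<le> f (insert e (set A))"
          using dA e es_U by (intro f_mono) auto
        then show ?thesis using t(8) le \<open>x = e\<close> by simp
      qed
    qed
    ultimately have "P (xs @ [e]) (sieve_step th A e) t"
      using t r unfolding P_def by auto
    then show ?case by (simp add: t_def r_def A_def)
  qed (use init in simp)
  from this[OF order_refl] have
    "P es T ((foldl (scan_step f c sieve_body) s0 es)\<lparr>cur := None\<rparr>)"
    by (simp add: P_def stores_def solved_def output_set_def items_in_def T)
  moreover have "run f c es (Pass sieve_body) s ((foldl (scan_step f c sieve_body) s0 es)\<lparr>cur := None\<rparr>)"
    unfolding s0_def by (intro run.Pass scan_foldl) simp
  ultimately show ?thesis unfolding P_def by blast
qed

primrec sieve :: "(nat \<Rightarrow> real) \<Rightarrow> nat \<Rightarrow> 'a list" where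
  "sieve \<tau> 0 = []"
| "sieve \<tau> (Suc j) = foldl (sieve_step (\<tau> (Suc j))) (sieve \<tau> j) es"

lemma sieve_feasible:
  assumes "\<And>i. 1 \<le> i \<Longrightarrow> i \<le> j \<Longrightarrow> 0 \<le> \<tau> i"
  shows "distinct (sieve \<tau> j) \<and> set (sieve \<tau> j) \<subseteq> set es \<and> cost (sieve \<tau> j) \<le> K"
  using assms
proof (induction j)
  case (Suc j)
  then have "sieve_inv (\<tau> (Suc j)) (sieve \<tau> j) es (sieve \<tau> (Suc j))"
    by (simp add: sieve_inv_foldl)
  then show ?case by (simp add: sieve_inv_def)
qed (use K_pos in simp)

lemma sieve_inv_Suc:
  assumes "\<And>i. 1 \<le> i \<Longrightarrow> i \<le> Suc j \<Longrightarrow> 0 \<le> \<tau> i"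
  shows "sieve_inv (\<tau> (Suc j)) (sieve \<tau> j) es (sieve \<tau> (Suc j))"
  using sieve_feasible[of j \<tau>] assms by (simp add: sieve_inv_foldl)

text \<open>After \<open>j\<close> sieve passes register 8 already holds the position of the next
  threshold; the additional pass and the first summands of \<open>queries\<close> and
  \<open>time\<close> come from the estimate and the initial assignments.\<close>

definition loop_inv :: "real \<Rightarrow> real \<Rightarrow> (nat \<Rightarrow> real) \<Rightarrow> nat \<Rightarrow> 'a state \<Rightarrow> bool" where
  "loop_inv \<epsilon> L \<tau> j s \<longleftrightarrow> stores c s (sieve \<tau> j) \<and> rreg s 0 = K \<and> rreg s 1 = \<epsilon> \<and> rreg s 4 = L \<and>
     rreg s 8 = real (Suc j) * (\<epsilon> / 2000) \<and> solved s \<and>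
     (\<forall>e\<in>set es. f {e} \<le> rreg s 2) \<and> (\<forall>i\<le>j. f (set (sieve \<tau> i)) \<le> rreg s 2) \<and>
     (\<forall>i<j. \<forall>e\<in>set es. cost (sieve \<tau> (Suc i)) + c e \<le> K \<longrightarrow>
        f (insert e (set (sieve \<tau> i))) \<le> rreg s 2) \<and>
     icells s \<subseteq> {..cell_bound} \<and> rcells s = {} \<and> passes s = 1 + j \<and>
     queries s = 4 * length es + j * (2 * length es) \<and>
     time s \<le> 20 * length es + 3 + j * (20 * length es + 2)"

lemma loop_inv_step:
  assumes inv: "loop_inv \<epsilon> L \<tau> j s"
    and \<tau>: "\<And>i. \<tau> i = 4 * L / K * (1 / (real i * (\<epsilon> / 2000)) - 1)"
    and \<tau>_nonneg: "\<And>i. 1 \<le> i \<Longrightarrow> i \<le> Suc j \<Longrightarrow> 0 \<le> \<tau> i"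
  shows "\<exists>t. run f c es (PSeq (Pass sieve_body) (Local (RSet 8 (RAdd (RReg 8) step_exp)))) (tick s) t \<and>
    loop_inv \<epsilon> L \<tau> (Suc j) t"
proof -
  let ?s = "tick s"
  have s: "stores c ?s (sieve \<tau> j)" "rreg ?s 0 = K" "solved ?s" "f (set (sieve \<tau> j)) \<le> rreg ?s 2"
    "icells ?s \<subseteq> {..cell_bound}" "rcells ?s = {}"
    using inv by (auto simp: loop_inv_def stores_def solved_def output_set_def items_in_def)
  have "rreg s 0 = K" "rreg s 4 = L" "rreg s 8 = real (Suc j) * (\<epsilon> / 2000)"
    using inv unfolding loop_inv_def by blast+
  then have \<tau>_val: "\<tau> (Suc j) = rval c ?s threshold_exp"
    by (simp only: threshold_exp_def \<tau> rval.simps tick_simps of_int_numeral of_int_1)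
  have T: "distinct (sieve \<tau> j)" "set (sieve \<tau> j) \<subseteq> set es" "cost (sieve \<tau> j) \<le> K"
    using sieve_feasible[of j \<tau>] \<tau>_nonneg by auto
  obtain r where run: "run f c es (Pass sieve_body) ?s r" and r: "stores c r (sieve \<tau> (Suc j))"
    "rreg r 0 = K" "rreg r 1 = rreg s 1" "rreg r 4 = rreg s 4" "rreg r 8 = rreg s 8" "solved r"
    "rreg s 2 \<le> rreg r 2" "f (set (sieve \<tau> (Suc j))) \<le> rreg r 2"
    "\<forall>e\<in>set es. cost (sieve \<tau> (Suc j)) + c e \<le> K \<longrightarrow> f (insert e (set (sieve \<tau> j))) \<le> rreg r 2"
    "icells r \<subseteq> {..cell_bound}" "rcells r = {}" "passes r = passes s + 1"
    "queries r = queries s + 2 * length es" "time r \<le> time s + 1 + 20 * length es"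
    using sieve_pass[OF s(1-3) T s(4) \<tau>_val \<tau>_nonneg[of "Suc j"] s(5,6) sieve.simps(2)]
    by auto
  define t where "t = eval_com f c (RSet 8 (RAdd (RReg 8) step_exp)) r"
  have "run f c es (Local (RSet 8 (RAdd (RReg 8) step_exp))) r t"
    unfolding t_def by (intro run.Local exec_eval_com) simp
  with run have "run f c es (PSeq (Pass sieve_body) (Local (RSet 8 (RAdd (RReg 8) step_exp)))) ?s t"
    by (rule run.PSeq)
  moreover have "loop_inv \<epsilon> L \<tau> (Suc j) t"
  proof -
    have t: "stores c t (sieve \<tau> (Suc j))" "rreg t 0 = K" "rreg t 1 = \<epsilon>" "rreg t 4 = L" "solved t"
      "rreg t 8 = rreg s 8 + \<epsilon> / 2000" "rreg t 2 = rreg r 2" "icells t = icells r"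
      "rcells t = rcells r" "passes t = passes r" "queries t = queries r" "time t = time r + 1"
      using r inv by (simp_all add: t_def step_exp_def stores_def solved_def output_set_def items_in_def
        loop_inv_def del: sieve.simps)
    have "\<forall>e\<in>set es. f {e} \<le> rreg t 2" using inv r(7) t(7) by (force simp: loop_inv_def)
    moreover have "\<forall>i\<le>Suc j. f (set (sieve \<tau> i)) \<le> rreg t 2"
      using inv r(7,8) t(7) by (auto simp: loop_inv_def le_Suc_eq simp del: sieve.simps)
    moreover have "\<forall>i<Suc j. \<forall>e\<in>set es. cost (sieve \<tau> (Suc i)) + c e \<le> K \<longrightarrow>
        f (insert e (set (sieve \<tau> i))) \<le> rreg t 2"
      using inv r(7,9) t(7) by (fastforce simp: loop_inv_def less_Suc_eq simp del: sieve.simps)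
    ultimately show ?thesis
      using inv t r by (simp add: loop_inv_def algebra_simps del: sieve.simps)
  qed
  ultimately show ?thesis by blast
qed

text \<open>After \<open>j\<close> passes the loop test compares
  \<open>(j + 2) * (\<epsilon> / 2000)\<close> with 1; the two bounds on \<open>J\<close> say that
  it first fails at \<open>j = J\<close>.\<close>

lemma sieve_loop:
  assumes inv: "loop_inv \<epsilon> L \<tau> j s" and "j \<le> J"
    and J: "(real J + 1) * (\<epsilon> / 2000) < 1" "1 \<le> (real J + 2) * (\<epsilon> / 2000)" and \<epsilon>: "0 < \<epsilon>"
    and \<tau>: "\<And>i. \<tau> i = 4 * L / K * (1 / (real i * (\<epsilon> / 2000)) - 1)"
    and \<tau>_nonneg: "\<And>i. 1 \<le> i \<Longrightarrow> i \<le> J \<Longrightarrow> 0 \<le> \<tau> i"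
  shows "\<exists>t. run f c es sieve_loop s t \<and> loop_inv \<epsilon> L \<tau> J t"
  using assms(2,1)
proof (induction j arbitrary: s rule: inc_induct)
  case base
  have "\<not> bval c s (RLess (RAdd (RReg 8) step_exp) (RConst 1))"
    using base J(2) by (simp add: loop_inv_def step_exp_def algebra_simps add_divide_distrib)
  then show ?case using base unfolding sieve_loop_def by (blast intro: run.PWhileFalse)
next
  case (step j)
  have "real j + 2 \<le> real J + 1" using step.hyps by simp
  then have "(real j + 2) * (\<epsilon> / 2000) \<le> (real J + 1) * (\<epsilon> / 2000)"
    using \<epsilon> by (intro mult_right_mono) auto
  then have "(real j + 2) * (\<epsilon> / 2000) < 1" using J(1) by linarith
  then have b: "bval c s (RLess (RAdd (RReg 8) step_exp) (RConst 1))"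
    using step.prems by (simp add: loop_inv_def step_exp_def algebra_simps add_divide_distrib)
  obtain t where t: "run f c es (PSeq (Pass sieve_body) (Local (RSet 8 (RAdd (RReg 8) step_exp)))) (tick s) t"
    "loop_inv \<epsilon> L \<tau> (Suc j) t"
    using loop_inv_step[OF step.prems \<tau>] \<tau>_nonneg step.hyps by auto
  from step.IH[OF t(2)] obtain u where "run f c es sieve_loop t u" "loop_inv \<epsilon> L \<tau> J u" by blast
  then show ?case using run.PWhileTrue[OF b t(1)] unfolding sieve_loop_def by blast
qed

section \<open>Assembling the approximation and resource bounds\<close>

lemma optimum_exists: "\<exists>Opt. is_arg_max f (feasible (set es) c K) Opt"
proof -
  have "finite {S. feasible (set es) c K S}"
    by (rule finite_subset[of _ "Pow (set es)"]) (auto simp: feasible_def)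
  moreover have "{S. feasible (set es) c K S} \<noteq> {}" using feasible_empty by blast
  ultimately have fin: "finite (f ` {S. feasible (set es) c K S})" "f ` {S. feasible (set es) c K S} \<noteq> {}"
    by auto
  obtain S where S: "feasible (set es) c K S" "f S = Max (f ` {S. feasible (set es) c K S})"
    using Max_in[OF fin] by force
  then have "\<not> f S < f T" if "feasible (set es) c K T" for T
    using Max_ge[OF fin(1), of "f T"] that by auto
  then show ?thesis using S(1) unfolding is_arg_max_def by blast
qed

text \<open>Instantiates the guarantee of the sieve with \<open>\<Lambda> = 4 * L\<close> and
  register 2 as \<open>best\<close>.\<close>

lemma sieve_loop_optimal:
  assumes inv: "loop_inv \<epsilon> L \<tau> J s" and \<epsilon>: "0 < \<epsilon>" "\<epsilon> < 1 / 2"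
    and J: "(real J + 1) * (\<epsilon> / 2000) < 1" "1 \<le> (real J + 2) * (\<epsilon> / 2000)"
    and \<tau>: "\<And>i. \<tau> i = 4 * L / K * (1 / (real i * (\<epsilon> / 2000)) - 1)"
    and \<tau>_nonneg: "\<And>i. 1 \<le> i \<Longrightarrow> i \<le> J \<Longrightarrow> 0 \<le> \<tau> i"
    and opt: "feasible (set es) c K Opt" "0 < f Opt" "f Opt \<le> 4 * L" "L \<le> 3 * f Opt"
  shows "(1 / 2 - \<epsilon>) * f Opt \<le> rreg s 2"
proof -
  have feas: "distinct (sieve \<tau> j)" "set (sieve \<tau> j) \<subseteq> set es" "cost (sieve \<tau> j) \<le> K"
    if "j \<le> J" for j using sieve_feasible[of j \<tau>] \<tau>_nonneg that by auto
  then have cost: "cost (sieve \<tau> j) = sum c (set (sieve \<tau> j))" if "j \<le> J" for j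
    using that cost_distinct by blast
  have inv_j: "sieve_inv (\<tau> (Suc j)) (sieve \<tau> j) es (sieve \<tau> (Suc j))" if "j < J" for j
    using that \<tau>_nonneg by (intro sieve_inv_Suc) auto
  show ?thesis
  proof (rule approximation_of_sieve[OF \<epsilon> refl _ _ opt(2,3) _ \<tau> J, where T = "\<lambda>j. set (sieve \<tau> j)"])
    show "Opt \<subseteq> set es" "sum c Opt \<le> K" using opt(1) by (auto simp: feasible_def)
    show "4 * L \<le> 12 * f Opt" using opt(4) by simp
    show "set (sieve \<tau> 0) = {}" by simp
    show "set (sieve \<tau> j) \<subseteq> set es" if "j \<le> J" for j using feas(2) that by blast
    show "\<tau> (Suc j) * (sum c (set (sieve \<tau> (Suc j))) - sum c (set (sieve \<tau> j)))
        \<le> f (set (sieve \<tau> (Suc j))) - f (set (sieve \<tau> j))"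
      "sum c (set (sieve \<tau> j)) \<le> sum c (set (sieve \<tau> (Suc j)))" if "j < J" for j
      using inv_j[OF that] cost[of j] cost[of "Suc j"] that
      unfolding sieve_inv_def by (simp_all del: sieve.simps)
    show "f (insert e (set (sieve \<tau> j))) - f (set (sieve \<tau> j)) \<le> \<tau> j * c e"
      if "1 \<le> j" "j \<le> J" "e \<in> set es" "sum c (set (sieve \<tau> j)) + c e \<le> K" for j e
    proof -
      obtain i where "j = Suc i" using \<open>1 \<le> j\<close> by (cases j) auto
      then show ?thesis using inv_j[of i] cost[of j] that
        unfolding sieve_inv_def by (simp del: sieve.simps)
    qed
    show "f (insert e (set (sieve \<tau> j))) \<le> rreg s 2"
      if "j < J" "e \<in> set es" "sum c (set (sieve \<tau> (Suc j))) + c e \<le> K" for j e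
      using inv that cost[of "Suc j"] unfolding loop_inv_def by (simp del: sieve.simps)
    show "f {e} \<le> rreg s 2" if "e \<in> set es" for e using inv that by (simp add: loop_inv_def)
    show "f (set (sieve \<tau> j)) \<le> rreg s 2" if "j \<le> J" for j using inv that by (simp add: loop_inv_def)
    show "0 \<le> rreg s 2" using inv by (simp add: loop_inv_def solved_def)
  qed
qed

text \<open>The additional cell 0 is absorbed into a factor 2 because \<open>min n K \<ge> 1\<close>
  on a nonempty stream.\<close>

lemma capacity_bounds:
  assumes "es \<noteq> []"
  shows "1 \<le> min (real (length es)) K" "0 \<le> log 2 (min (real (length es)) K)"
    "real (Suc cell_bound) \<le> 2 * min (real (length es)) K"
proof -
  obtain e where "e \<in> set es" using assms by (cases es) auto
  then have "1 \<le> K" using cost_ge_1 cost_le_K by force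
  moreover have "1 \<le> real (length es)" using assms by (cases es) auto
  ultimately show 1: "1 \<le> min (real (length es)) K" by simp
  then show "0 \<le> log 2 (min (real (length es)) K)" by (subst zero_le_log_cancel_iff) linarith+
  have "real cell_bound \<le> min (real (length es)) K" using 1 unfolding cell_bound_def by linarith
  then show "real (Suc cell_bound) \<le> 2 * min (real (length es)) K" using 1 by linarith
qed

lemma sieve_max_correct:
  assumes \<epsilon>: "0 < \<epsilon>"
  defines "n \<equiv> real (length es)" and "K' \<equiv> min (real (length es)) K"
  shows "\<exists>s. run f c es sieve_max (init_state K \<epsilon>) s \<and>
    approximation (1 / 2 - \<epsilon>) (set es) f c K (output_set s) \<and>
    real (space s) \<le> 50000 * K' \<and> real (passes s) \<le> 50000 * (1 / \<epsilon>) \<and>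
    real (queries s) \<le> 50000 * (n * (1 / \<epsilon> + log 2 K')) \<and>
    real (time s) \<le> 50000 * (n * (1 / \<epsilon> + log 2 K'))"
proof -
  obtain Opt where Opt: "is_arg_max f (feasible (set es) c K) Opt" using optimum_exists by blast
  then have opt: "feasible (set es) c K Opt" and max: "f S \<le> f Opt" if "feasible (set es) c K S" for S
    using that by (auto simp: is_arg_max_def not_less)
  have Opt_nonneg: "0 \<le> f Opt" using opt[OF feasible_empty] es_U by (intro f_nonneg) (auto simp: feasible_def)
  \<comment> \<open>It suffices to bound queries and time by multiples of
    \<open>n / \<epsilon>\<close>: the logarithm is nonnegative on a nonempty stream, and
    \<open>n = 0\<close> otherwise.\<close>
  have bound: "n * (1 / \<epsilon>) \<le> n * (1 / \<epsilon> + log 2 K')"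
  proof (cases "es = []")
    case False
    show ?thesis using capacity_bounds(2)[OF False] unfolding n_def K'_def by (intro mult_left_mono) auto
  qed (simp add: n_def)
  have K'_nonneg: "0 \<le> K'" using K_pos by (simp add: K'_def)
  show ?thesis
  proof (cases "\<epsilon> < 1 / 2")
    case False
    let ?s = "init_state K \<epsilon> :: 'a state"
    have "run f c es sieve_max ?s ?s"
      unfolding sieve_max_def using False
      by (intro run.PCondFalse run.Local exec.Skip) (simp add: init_state_def)
    moreover have out: "output_set ?s = {}" by (simp add: output_set_def init_state_def items_in_def)
    moreover have "approximation (1 / 2 - \<epsilon>) (set es) f c K {}"
    proof -
      \<comment> \<open>For \<open>\<epsilon> \<ge> 1 / 2\<close> the empty output meets the
        guarantee trivially.\<close>
      have "(1 / 2 - \<epsilon>) * f Opt \<le> 0" using False Opt_nonneg by (simp add: mult_nonpos_nonneg)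
      then show ?thesis using Opt feasible_empty f_nonneg[of "{}"] unfolding approximation_def
        by (intro conjI exI[of _ Opt]) auto
    qed
    moreover have "0 \<le> n * (1 / \<epsilon> + log 2 K')" using bound \<epsilon> by (simp add: n_def order_trans[rotated])
    ultimately show ?thesis using K'_nonneg \<epsilon>
      by (intro exI[of _ ?s]) (simp add: space_def init_state_def)
  next
    case True
    then have inv_eps: "2 \<le> 1 / \<epsilon>" using \<epsilon> by (simp add: field_simps)
    obtain t where run1: "run f c es (Pass estimate_body) (init_state K \<epsilon>) t"
      and inv: "estimate_inv \<epsilon> es t" using estimate_pass[OF refl] by blast
    have b1: "bval c (init_state K \<epsilon> :: 'a state) (RLess (RMul (RConst 2) (RReg 1)) (RConst 1))"
      using True by (simp add: init_state_def)
    obtain B where B: "stores c t B" "block_inv es (rreg t 3) B"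
      "rreg t 4 = (if es = [] then 0 else rreg t 3 + f (set B))"
      using inv unfolding estimate_inv_def by blast
    have t: "rreg t 0 = K" "rreg t 1 = \<epsilon>" "solved t" "\<forall>e\<in>set es. f {e} \<le> rreg t 2" "nreg t 0 \<le> 1"
      "icells t \<subseteq> (if es = [] then {} else {..cell_bound})" "rcells t = {}" "passes t = 1"
      "queries t = 4 * length es" "time t \<le> 20 * length es"
      using inv unfolding estimate_inv_def by auto
    note est = block_inv_estimate[OF B(2) opt[OF feasible_empty] max]
    have space: "real (space s) \<le> 50000 * K'"
      if "icells s \<subseteq> (if es = [] then {} else {..cell_bound})" "rcells s = {}" for s :: "'a state"
    proof (cases "es = []")
      case False
      then have "card (icells s) \<le> Suc cell_bound"
        using that card_mono[of "{..cell_bound}" "icells s"] by simp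
      then have "real (space s) \<le> real (Suc cell_bound)" using that by (simp add: space_def)
      then show ?thesis using capacity_bounds(3)[OF False] K'_nonneg by (simp add: K'_def)
    qed (use that K'_nonneg in \<open>simp add: space_def\<close>)
    show ?thesis
    proof (cases "0 < rreg t 4")
      case False
      have "\<not> bval c t (RLess (RConst 0) (RReg 4))" using False by simp
      then have "run f c es sieve_max (init_state K \<epsilon>) t"
        unfolding sieve_max_def
        by (intro run.PCondTrue[OF b1] run.PSeq[OF run1] run.PCondFalse run.Local exec.Skip)
      moreover have "approximation (1 / 2 - \<epsilon>) (set es) f c K (output_set t)"
      proof (cases "es = []")
        case True
        moreover have "feasible (set es) c K (output_set t)" using t(3) by (simp add: solved_def)
        ultimately have "output_set t = {}" "Opt = {}"
          using opt[OF feasible_empty] by (auto simp: feasible_def)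
        moreover have "(1 / 2 - \<epsilon>) * f {} \<le> 1 * f {}"
          using \<epsilon> f_nonneg[of "{}"] by (intro mult_right_mono) auto
        ultimately show ?thesis using t(3) Opt unfolding approximation_def solved_def
          by (intro conjI exI[of _ Opt]) auto
      next
        case nonempty: False
        then have "f Opt = 0" using est(1) B(3) False Opt_nonneg by simp
        then show ?thesis using t(3) Opt unfolding approximation_def solved_def
          by (intro conjI exI[of _ Opt]) auto
      qed
      moreover have "real (queries t) \<le> 50000 * (n * (1 / \<epsilon> + log 2 K'))"
        "real (time t) \<le> 50000 * (n * (1 / \<epsilon> + log 2 K'))"
      proof -
        have "n * 2 \<le> n * (1 / \<epsilon>)" using inv_eps by (intro mult_left_mono) (auto simp: n_def)
        moreover have "real (queries t) = 4 * n" "real (time t) \<le> 20 * n"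
          using t(9,10) by (simp_all add: n_def)
        moreover have "0 \<le> n" by (simp add: n_def)
        ultimately show "real (queries t) \<le> 50000 * (n * (1 / \<epsilon> + log 2 K'))"
          "real (time t) \<le> 50000 * (n * (1 / \<epsilon> + log 2 K'))" using bound by linarith+
      qed
      moreover have "real (passes t) \<le> 50000 * (1 / \<epsilon>)" using t(8) inv_eps by simp
      ultimately show ?thesis using space[OF t(6,7)] by blast
    next
      case pos: True
      then have nonempty: "es \<noteq> []" using B(3) by auto
      define L where "L = rreg t 4"
      have L: "0 < L" "f Opt \<le> 4 * L" "L \<le> 3 * f Opt" using est B(3) nonempty pos by (auto simp: L_def)
      define \<delta> where "\<delta> = \<epsilon> / 2000"
      define \<tau> where "\<tau> i = 4 * L / K * (1 / (real i * (\<epsilon> / 2000)) - 1)" for i :: nat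
      \<comment> \<open>The number of sieve passes: the integer with
        \<open>J + 1 < 1 / \<delta> \<le> J + 2\<close>, at which the loop test first fails.\<close>
      define J where "J = nat (\<lceil>1 / \<delta>\<rceil> - 2)"
      have d: "0 < \<delta>" "\<delta> < 1 / 2" using \<epsilon> True by (auto simp: \<delta>_def)
      have "2 < 1 / \<delta>" using d by (simp add: field_simps)
      then have J': "real J + 1 < 1 / \<delta>" "1 / \<delta> \<le> real J + 2" unfolding J_def by linarith+
      then have J: "(real J + 1) * (\<epsilon> / 2000) < 1" "1 \<le> (real J + 2) * (\<epsilon> / 2000)"
        unfolding \<delta>_def[symmetric] using d by (simp_all add: field_simps)
      have \<tau>_nonneg: "0 \<le> \<tau> i" if "1 \<le> i" "i \<le> J" for i
      proof -
        have "real i * \<delta> \<le> (real J + 1) * \<delta>" using that d by (intro mult_right_mono) auto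
        then have "real i * \<delta> \<le> 1" using J(1) unfolding \<delta>_def[symmetric] by linarith
        moreover have "0 < real i * \<delta>" using that d by simp
        ultimately have "1 \<le> 1 / (real i * \<delta>)" by simp
        then show ?thesis unfolding \<tau>_def \<delta>_def[symmetric] using L K_pos by simp
      qed
      let ?p = "Seq (NSet 1 (NConst 0)) (Seq (RSet 5 (RConst 0)) (RSet 8 step_exp))"
      define t0 where "t0 = eval_com f c ?p t"
      have run2: "run f c es (Local ?p) t t0" unfolding t0_def by (intro run.Local exec_eval_com) simp
      \<comment> \<open>The empty list is never recorded as a candidate; monotonicity bounds its
        value by that of a singleton.\<close>
      have best0: "f {} \<le> rreg t 2"
      proof -
        obtain e where e: "e \<in> set es" using nonempty by (cases es) auto
        then have "f {} \<le> f {e}" using es_U by (intro f_mono) auto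
        then show ?thesis using t(4) e by force
      qed
      have "loop_inv \<epsilon> L \<tau> 0 t0"
        using t best0 nonempty
        by (simp add: loop_inv_def t0_def stores_def solved_def output_set_def items_in_def L_def
          step_exp_def)
      then obtain s where run3: "run f c es sieve_loop t0 s" and s: "loop_inv \<epsilon> L \<tau> J s"
        using sieve_loop[OF _ _ J \<epsilon> \<tau>_def \<tau>_nonneg] by blast
      have "bval c t (RLess (RConst 0) (RReg 4))" using pos by simp
      note run.PCondTrue[OF this run.PSeq[OF run2 run3]]
      then have "run f c es sieve_max (init_state K \<epsilon>) s"
        unfolding sieve_max_def by (intro run.PCondTrue[OF b1] run.PSeq[OF run1])
      moreover have "approximation (1 / 2 - \<epsilon>) (set es) f c K (output_set s)"
      proof -
        have "0 < f Opt" using L by linarith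
        then have "(1 / 2 - \<epsilon>) * f Opt \<le> rreg s 2"
          using sieve_loop_optimal[OF s \<epsilon> True J \<tau>_def \<tau>_nonneg opt[OF feasible_empty] _ L(2,3)] by blast
        then show ?thesis using s Opt unfolding approximation_def loop_inv_def solved_def
          by (intro conjI exI[of _ Opt]) auto
      qed
      moreover have "real J \<le> 2000 * (1 / \<epsilon>)" using J'(1) by (simp add: \<delta>_def)
      moreover have "real (passes s) = 1 + real J" using s by (simp add: loop_inv_def)
      moreover have "real (queries s) \<le> 50000 * (n * (1 / \<epsilon> + log 2 K'))"
        "real (time s) \<le> 50000 * (n * (1 / \<epsilon> + log 2 K'))"
      proof -
        have n1: "1 \<le> n" using nonempty by (cases es) (auto simp: n_def)
        have q: "real (queries s) = 4 * n + real J * (2 * n)"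
          using s by (simp add: loop_inv_def n_def)
        have "time s \<le> 20 * length es + 3 + J * (20 * length es + 2)"
          using s by (simp add: loop_inv_def)
        then have "real (time s) \<le> real (20 * length es + 3 + J * (20 * length es + 2))"
          by (simp only: of_nat_le_iff)
        then have tm: "real (time s) \<le> 20 * n + 3 + real J * (20 * n + 2)"
          by (simp add: n_def algebra_simps)
        have Jn: "real J * n \<le> 2000 * (n * (1 / \<epsilon>))"
          using mult_right_mono[OF \<open>real J \<le> 2000 * (1 / \<epsilon>)\<close>, of n] n1 by (simp add: mult_ac)
        have JJ: "real J \<le> real J * n" using n1 by (simp add: mult_le_cancel_left1)
        have n2: "n * 2 \<le> n * (1 / \<epsilon>)" using inv_eps n1 by (intro mult_left_mono) auto
        show "real (queries s) \<le> 50000 * (n * (1 / \<epsilon> + log 2 K'))"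
          using q Jn n2 n1 bound by linarith
        \<comment> \<open>Since \<open>J * n \<le> 2000 * n / \<epsilon>\<close> and
          \<open>n \<le> n / (2 * \<epsilon>)\<close>, the coefficient of
          \<open>n / \<epsilon>\<close> is at most \<open>44000 + 11.5\<close>, below 50000.\<close>
        have "real (time s) \<le> 23 * n + 22 * (real J * n)"
          using tm n1 JJ by (simp add: algebra_simps)
        then show "real (time s) \<le> 50000 * (n * (1 / \<epsilon> + log 2 K'))"
          using Jn n2 n1 bound by linarith
      qed
      moreover have "real (space s) \<le> 50000 * K'"
        using s nonempty by (intro space) (auto simp: loop_inv_def)
      ultimately show ?thesis using inv_eps by (intro exI[of _ s]) auto
    qed
  qed
qed

end

theorem theorem2:
  shows "\<exists>(P :: prog) (C :: real). C > 0 \<and>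
    (\<forall>(\<epsilon> :: real) (U :: 'a set) (es :: 'a list) (f :: 'a set \<Rightarrow> real) (c :: 'a \<Rightarrow> real) (K :: real).
       \<epsilon> > 0 \<and> knapsack_instance U es f c K \<longrightarrow>
       (let n = real (length es); K' = min n K in
        \<exists>s. run f c es P (init_state K \<epsilon>) s \<and>
            approximation (1 / 2 - \<epsilon>) (set es) f c K (output_set s) \<and>
            real (space s) \<le> C * K' \<and>
            real (passes s) \<le> C * (1 / \<epsilon>) \<and>
            real (queries s) \<le> C * (n * (1 / \<epsilon> + log 2 K')) \<and>
            real (time s) \<le> C * (n * (1 / \<epsilon> + log 2 K'))))"
proof (intro exI[of _ sieve_max] exI[of _ 50000] conjI allI impI)
  fix \<epsilon> :: real and U :: "'a set" and es :: "'a list" and f c and K :: real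
  assume "0 < \<epsilon> \<and> knapsack_instance U es f c K"
  then interpret knapsack U es f c K by unfold_locales simp
  show "let n = real (length es); K' = min n K in
        \<exists>s. run f c es sieve_max (init_state K \<epsilon>) s \<and>
            approximation (1 / 2 - \<epsilon>) (set es) f c K (output_set s) \<and>
            real (space s) \<le> 50000 * K' \<and>
            real (passes s) \<le> 50000 * (1 / \<epsilon>) \<and>
            real (queries s) \<le> 50000 * (n * (1 / \<epsilon> + log 2 K')) \<and>
            real (time s) \<le> 50000 * (n * (1 / \<epsilon> + log 2 K'))"
    unfolding Let_def using sieve_max_correct \<open>0 < \<epsilon> \<and> _\<close> by blast
qed simp

end
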